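(* Let $D,\tilde L,Q\in\mathbb{R}^{m\times n}$, $\Omega\subset\{1,\dots,m\}\times\{1,\dots,n\}$, $\rho>0$, $\delta\ge 0$ and $\xi=\frac{1}{\sqrt{\max\{m,n\}}}$. Consider the problem $$(P_{ns}):\quad \min_{L,S\in\mathbb{R}^{m\times n}}\left\{\xi\|\pi_\Omega(S)\|_1+\langle Q,L-\tilde L\rangle+\frac{1}{2\rho}\|L-\tilde L\|_F^2:\ \|L+S-\pi_\Omega(D)\|_F\le\delta\right\},$$ and put $q(\tilde L):=\tilde L-\rho Q$. The optimal solution $(L^*,S^* )$ to problem $(P_{ns})$ can be written in closed form as follows. (1) When $\delta>0$: $$S^*=\operatorname{sgn}\!\left(\pi_\Omega(D-q(\tilde L))\right)\odot\max\left\{\left|\pi_\Omega(D-q(\tilde L))\right|-\xi\frac{1+\rho\theta^*}{\theta^*}E,\ \mathbf{0}\right\}-\pi_{\Omega^c}(q(\tilde L)),$$ $$L^*=\pi_\Omega\!\left(\frac{\rho\theta^*}{1+\rho\theta^*}(D-S^* )+\frac{1}{1+\rho\theta^*}q(\tilde L)\right)+\pi_{\Omega^c}(q(\tilde L)),$$ where $\theta^*=0$ if $\|\pi_\Omega(D-q(\tilde L))\|_F\le\delta$; otherwise, $\theta^*$ is the unique positive solution of the nonlinear equation $\phi(\theta)=\delta$, where $$\phi(\theta):=\left\|\min\left\{\frac{\xi}{\theta}E,\ \frac{1}{1+\rho\theta}\left|\pi_\Omega(D-q(\tilde L))\right|\right\}\right\|_F.$$ Moreover, $\theta^*$ can be efficiently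 computed in $\mathcal{O}(|\Omega|\log(|\Omega|))$ time. (2) When $\delta=0$: $$S^*=\operatorname{sgn}\!\left(\pi_\Omega(D-q(\tilde L))\right)\odot\max\left\{\left|\pi_\Omega(D-q(\tilde L))\right|-\xi\rho E,\ \mathbf{0}\right\}-\pi_{\Omega^c}(q(\tilde L)),$$ and $L^*=\pi_\Omega(D)-S^*$.
   Context: For $X,Y\in\mathbb{R}^{m\times n}$: $\|X\|_1:=\sum_{i,j}|X_{ij}|$, $\|X\|_F$ is the Frobenius norm, and $\langle X,Y\rangle=\sum_{i,j}X_{ij}Y_{ij}$. The projection $\pi_\Omega:\mathbb{R}^{m\times n}\to\mathbb{R}^{m\times n}$ is given by $(\pi_\Omega(X))_{ij}=X_{ij}$ if $(i,j)\in\Omega$ and $0$ otherwise; $\Omega^c$ is the complement of $\Omega$ in $\{1,\dots,m\}\times\{1,\dots,n\}$, and $\pi_{\Omega^c}$ is defined likewise. $E$ and $\mathbf{0}$ are the $m\times n$ matrices of all ones and all zeros; $\odot$ is componentwise multiplication; $\operatorname{sgn}$, $|\cdot|$, $\max$ and $\min$ act componentwise on matrices, with $\operatorname{sgn}(0)=0$. When $\theta^*=0$, the quantity $\xi\frac{1+\rho\theta^*}{\theta^*}$ is read as $+\infty$, so the componentwise maximum in the formula for $S^*$ is $\mathbf{0}$ and the formulas give $S^*=-\pi_{\Omega^c}(q(\tilde L))$, $L^*=q(\tilde L)$. Running time is counted in exact real arithmetic, with $q(\tilde L)$ given: each arithmetic operation, comparison, and computation of the roots of a polynomial of degree at most four (by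 the algebraic formulas) takes $\mathcal{O}(1)$ time. *)

theory Defs
  imports
    Complex_Main
    "HOL-Library.Landau_Symbols"
    "HOL-Computational_Algebra.Polynomial"
    "Jordan_Normal_Form.Matrix"
begin

section \<open>Componentwise operations, norms and projections\<close>

definition ones_mat :: "nat \<Rightarrow> nat \<Rightarrow> real mat" where
  "ones_mat m n = mat m n (\<lambda>_. 1)"

definition hadamard :: "real mat \<Rightarrow> real mat \<Rightarrow> real mat"  (infixl \<open>\<odot>\<close> 70) where
  "A \<odot> B = mat (dim_row A) (dim_col A) (\<lambda>ij. A $$ ij * B $$ ij)"

definition max_mat :: "real mat \<Rightarrow> real mat \<Rightarrow> real mat" where
  "max_mat A B = mat (dim_row A) (dim_col A) (\<lambda>ij. max (A $$ ij) (B $$ ij))"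

definition min_mat :: "real mat \<Rightarrow> real mat \<Rightarrow> real mat" where
  "min_mat A B = mat (dim_row A) (dim_col A) (\<lambda>ij. min (A $$ ij) (B $$ ij))"

definition l1_norm :: "real mat \<Rightarrow> real" where
  "l1_norm A = (\<Sum>ij \<in> {..<dim_row A} \<times> {..<dim_col A}. \<bar>A $$ ij\<bar>)"

definition mat_inner :: "real mat \<Rightarrow> real mat \<Rightarrow> real" where
  "mat_inner A B = (\<Sum>ij \<in> {..<dim_row A} \<times> {..<dim_col A}. A $$ ij * B $$ ij)"

definition fro_norm :: "real mat \<Rightarrow> real" where
  "fro_norm A = sqrt (\<Sum>ij \<in> {..<dim_row A} \<times> {..<dim_col A}. (A $$ ij)\<^sup>2)"

definition proj :: "(nat \<times> nat) set \<Rightarrow> real mat \<Rightarrow> real mat" where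
  "proj \<Omega> A = mat (dim_row A) (dim_col A) (\<lambda>ij. if ij \<in> \<Omega> then A $$ ij else 0)"

text \<open>Rows and columns are numbered from 0, as usual for \<^typ>\<open>'a mat\<close>.\<close>

definition positions :: "nat \<Rightarrow> nat \<Rightarrow> (nat \<times> nat) set" where
  "positions m n = {..<m} \<times> {..<n}"


section \<open>The optimization problem\<close>

definition pns_data ::
  "nat \<Rightarrow> nat \<Rightarrow> real mat \<Rightarrow> real mat \<Rightarrow> real mat \<Rightarrow> (nat \<times> nat) set \<Rightarrow> real \<Rightarrow> real \<Rightarrow> bool" where
  "pns_data m n D Lt Q \<Omega> \<rho> \<delta> \<longleftrightarrow>
     0 < m \<and> 0 < n \<and>
     D \<in> carrier_mat m n \<and> Lt \<in> carrier_mat m n \<and> Q \<in> carrier_mat m n \<and>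
     \<Omega> \<subseteq> positions m n \<and> 0 < \<rho> \<and> 0 \<le> \<delta>"

definition xi :: "nat \<Rightarrow> nat \<Rightarrow> real" where
  "xi m n = 1 / sqrt (real (max m n))"

definition pns_objective ::
  "nat \<Rightarrow> nat \<Rightarrow> real mat \<Rightarrow> real mat \<Rightarrow> (nat \<times> nat) set \<Rightarrow> real \<Rightarrow> real mat \<times> real mat \<Rightarrow> real" where
  "pns_objective m n Lt Q \<Omega> \<rho> = (\<lambda>(L, S).
     xi m n * l1_norm (proj \<Omega> S) + mat_inner Q (L - Lt) + 1 / (2 * \<rho>) * (fro_norm (L - Lt))\<^sup>2)"

definition pns_feasible ::
  "nat \<Rightarrow> nat \<Rightarrow> real mat \<Rightarrow> (nat \<times> nat) set \<Rightarrow> real \<Rightarrow> real mat \<times> real mat \<Rightarrow> bool" where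
  "pns_feasible m n D \<Omega> \<delta> = (\<lambda>(L, S).
     L \<in> carrier_mat m n \<and> S \<in> carrier_mat m n \<and> fro_norm (L + S - proj \<Omega> D) \<le> \<delta>)"

definition pns_optimal ::
  "nat \<Rightarrow> nat \<Rightarrow> real mat \<Rightarrow> real mat \<Rightarrow> real mat \<Rightarrow> (nat \<times> nat) set \<Rightarrow> real \<Rightarrow> real \<Rightarrow>
   real mat \<times> real mat \<Rightarrow> bool" where
  "pns_optimal m n D Lt Q \<Omega> \<rho> \<delta> =
     is_arg_min (pns_objective m n Lt Q \<Omega> \<rho>) (pns_feasible m n D \<Omega> \<delta>)"

definition q_mat :: "real \<Rightarrow> real mat \<Rightarrow> real mat \<Rightarrow> real mat" where
  "q_mat \<rho> Q Lt = Lt - \<rho> \<cdot>\<^sub>m Q"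


section \<open>The closed form\<close>

text \<open>In this section \<open>q\<close> stands for \<^term>\<open>q_mat \<rho> Q Lt\<close> and \<open>A\<close> for \<^term>\<open>proj \<Omega> (D - q)\<close>.\<close>

definition phi :: "nat \<Rightarrow> nat \<Rightarrow> real \<Rightarrow> real mat \<Rightarrow> real \<Rightarrow> real" where
  "phi m n \<rho> A \<theta> =
     fro_norm (min_mat ((xi m n / \<theta>) \<cdot>\<^sub>m ones_mat m n) ((1 / (1 + \<rho> * \<theta>)) \<cdot>\<^sub>m map_mat abs A))"

definition theta_star :: "nat \<Rightarrow> nat \<Rightarrow> real \<Rightarrow> real \<Rightarrow> real mat \<Rightarrow> real" where
  "theta_star m n \<rho> \<delta> A =
     (if fro_norm A \<le> \<delta> then 0 else (THE \<theta>. 0 < \<theta> \<and> phi m n \<rho> A \<theta> = \<delta>))"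

text \<open>\<open>excess m n A \<tau>\<close> is \<open>max {|A| - \<tau> E, 0}\<close>.\<close>

definition excess :: "nat \<Rightarrow> nat \<Rightarrow> real mat \<Rightarrow> real \<Rightarrow> real mat" where
  "excess m n A \<tau> = max_mat (map_mat abs A - \<tau> \<cdot>\<^sub>m ones_mat m n) (0\<^sub>m m n)"

text \<open>For \<open>\<theta> = 0\<close> the threshold \<open>\<xi> (1 + \<rho> \<theta>) / \<theta>\<close> means \<open>+\<infinity>\<close>, and the maximum is the zero matrix.
  This case has to be split off because division by zero yields zero in HOL.\<close>

definition S_noisy ::
  "nat \<Rightarrow> nat \<Rightarrow> real mat \<Rightarrow> real mat \<Rightarrow> (nat \<times> nat) set \<Rightarrow> real \<Rightarrow> real \<Rightarrow> real mat" where
  "S_noisy m n D q \<Omega> \<rho> \<theta> =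
     (let A = proj \<Omega> (D - q) in
      map_mat sgn A \<odot>
        (if \<theta> = 0 then 0\<^sub>m m n else excess m n A (xi m n * ((1 + \<rho> * \<theta>) / \<theta>)))
      - proj (positions m n - \<Omega>) q)"

definition L_noisy ::
  "nat \<Rightarrow> nat \<Rightarrow> real mat \<Rightarrow> real mat \<Rightarrow> (nat \<times> nat) set \<Rightarrow> real \<Rightarrow> real \<Rightarrow> real mat" where
  "L_noisy m n D q \<Omega> \<rho> \<theta> =
     proj \<Omega> ((\<rho> * \<theta> / (1 + \<rho> * \<theta>)) \<cdot>\<^sub>m (D - S_noisy m n D q \<Omega> \<rho> \<theta>) + (1 / (1 + \<rho> * \<theta>)) \<cdot>\<^sub>m q)
     + proj (positions m n - \<Omega>) q"

definition S_exact ::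
  "nat \<Rightarrow> nat \<Rightarrow> real mat \<Rightarrow> real mat \<Rightarrow> (nat \<times> nat) set \<Rightarrow> real \<Rightarrow> real mat" where
  "S_exact m n D q \<Omega> \<rho> =
     (let A = proj \<Omega> (D - q) in
      map_mat sgn A \<odot> excess m n A (xi m n * \<rho>) - proj (positions m n - \<Omega>) q)"

definition L_exact ::
  "nat \<Rightarrow> nat \<Rightarrow> real mat \<Rightarrow> real mat \<Rightarrow> (nat \<times> nat) set \<Rightarrow> real \<Rightarrow> real mat" where
  "L_exact m n D q \<Omega> \<rho> = proj \<Omega> D - S_exact m n D q \<Omega> \<rho>"


section \<open>Exact real arithmetic with unit costs\<close>

text \<open>
  A while language over two memories, one holding natural numbers (for counting and addressing)
  and one holding real numbers. Both consist of named arrays with unbounded random access; a scalar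
  is cell 0 of an array. Real numbers enter a program only as input or as images of
  natural numbers, and there is no way back from the reals to the naturals other than
  branching on a comparison (in particular no rounding).
  Division by zero yields zero, as in HOL; subtraction of natural numbers is truncated.
\<close>

datatype nexp =
    NConst nat
  | NRead string nexp
  | NAdd nexp nexp
  | NSub nexp nexp
  | NMul nexp nexp

datatype rexp =
    RRead string nexp
  | RNat nexp
  | RAdd rexp rexp
  | RSub rexp rexp
  | RMul rexp rexp
  | RDiv rexp rexp

datatype bexp =
    NLess nexp nexp
  | RLess rexp rexp
  | BNot bexp
  | BAnd bexp bexp

text \<open>\<open>Roots x y a0 a1 a2 a3 a4\<close> stores the distinct real roots of the polynomial with these
  coefficients (constant coefficient first) into the real array \<open>x\<close> in increasing order, and their
  number into cell 0 of \<open>y\<close>.\<close>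

datatype com =
    SKIP
  | NWrite string nexp nexp
  | RWrite string nexp rexp
  | Roots string string rexp rexp rexp rexp rexp
  | Seq com com
  | If bexp com com
  | While bexp com

record state =
  nats :: "string \<Rightarrow> nat \<Rightarrow> nat"
  reals :: "string \<Rightarrow> nat \<Rightarrow> real"

primrec nval :: "nexp \<Rightarrow> state \<Rightarrow> nat" where
  "nval (NConst k) s = k"
| "nval (NRead x e) s = nats s x (nval e s)"
| "nval (NAdd e f) s = nval e s + nval f s"
| "nval (NSub e f) s = nval e s - nval f s"
| "nval (NMul e f) s = nval e s * nval f s"

primrec rval :: "rexp \<Rightarrow> state \<Rightarrow> real" where
  "rval (RRead x e) s = reals s x (nval e s)"
| "rval (RNat e) s = real (nval e s)"
| "rval (RAdd e f) s = rval e s + rval f s"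
| "rval (RSub e f) s = rval e s - rval f s"
| "rval (RMul e f) s = rval e s * rval f s"
| "rval (RDiv e f) s = rval e s / rval f s"

primrec bval :: "bexp \<Rightarrow> state \<Rightarrow> bool" where
  "bval (NLess e f) s \<longleftrightarrow> nval e s < nval f s"
| "bval (RLess e f) s \<longleftrightarrow> rval e s < rval f s"
| "bval (BNot b) s \<longleftrightarrow> \<not> bval b s"
| "bval (BAnd b c) s \<longleftrightarrow> bval b s \<and> bval c s"

primrec ncost :: "nexp \<Rightarrow> nat" where
  "ncost (NConst k) = 1"
| "ncost (NRead x e) = 1 + ncost e"
| "ncost (NAdd e f) = 1 + ncost e + ncost f"
| "ncost (NSub e f) = 1 + ncost e + ncost f"
| "ncost (NMul e f) = 1 + ncost e + ncost f"

primrec rcost :: "rexp \<Rightarrow> nat" where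
  "rcost (RRead x e) = 1 + ncost e"
| "rcost (RNat e) = 1 + ncost e"
| "rcost (RAdd e f) = 1 + rcost e + rcost f"
| "rcost (RSub e f) = 1 + rcost e + rcost f"
| "rcost (RMul e f) = 1 + rcost e + rcost f"
| "rcost (RDiv e f) = 1 + rcost e + rcost f"

primrec bcost :: "bexp \<Rightarrow> nat" where
  "bcost (NLess e f) = 1 + ncost e + ncost f"
| "bcost (RLess e f) = 1 + rcost e + rcost f"
| "bcost (BNot b) = 1 + bcost b"
| "bcost (BAnd b c) = 1 + bcost b + bcost c"

text \<open>The zero polynomial yields the empty list, since \<^const>\<open>sorted_list_of_set\<close> does so for
  infinite sets.\<close>

definition real_roots :: "real \<Rightarrow> real \<Rightarrow> real \<Rightarrow> real \<Rightarrow> real \<Rightarrow> real list" where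
  "real_roots a0 a1 a2 a3 a4 = sorted_list_of_set {x. poly [:a0, a1, a2, a3, a4:] x = 0}"

definition write_list :: "real list \<Rightarrow> (nat \<Rightarrow> real) \<Rightarrow> nat \<Rightarrow> real" where
  "write_list xs f i = (if i < length xs then xs ! i else f i)"

text \<open>\<open>exec c s t s'\<close>: started in state \<open>s\<close>, program \<open>c\<close> halts after exactly \<open>t\<close> steps in
  state \<open>s'\<close>.\<close>

inductive exec :: "com \<Rightarrow> state \<Rightarrow> nat \<Rightarrow> state \<Rightarrow> bool" where
  Skip: "exec SKIP s 1 s"
| NWrite:
    "exec (NWrite x e f) s (1 + ncost e + ncost f)
       (s\<lparr>nats := (nats s)(x := (nats s x)(nval e s := nval f s))\<rparr>)"
| RWrite:
    "exec (RWrite x e f) s (1 + ncost e + rcost f)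
       (s\<lparr>reals := (reals s)(x := (reals s x)(nval e s := rval f s))\<rparr>)"
| Roots:
    "xs = real_roots (rval a0 s) (rval a1 s) (rval a2 s) (rval a3 s) (rval a4 s) \<Longrightarrow>
     exec (Roots x y a0 a1 a2 a3 a4) s
       (1 + rcost a0 + rcost a1 + rcost a2 + rcost a3 + rcost a4)
       (s\<lparr>reals := (reals s)(x := write_list xs (reals s x)),
          nats := (nats s)(y := (nats s y)(0 := length xs))\<rparr>)"
| Seq:
    "exec c s t s' \<Longrightarrow> exec d s' u s'' \<Longrightarrow> exec (Seq c d) s (t + u) s''"
| IfTrue:
    "bval b s \<Longrightarrow> exec c s t s' \<Longrightarrow> exec (If b c d) s (1 + bcost b + t) s'"
| IfFalse:
    "\<not> bval b s \<Longrightarrow> exec d s t s' \<Longrightarrow> exec (If b c d) s (1 + bcost b + t) s'"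
| WhileFalse:
    "\<not> bval b s \<Longrightarrow> exec (While b c) s (1 + bcost b) s"
| WhileTrue:
    "bval b s \<Longrightarrow> exec c s t s' \<Longrightarrow> exec (While b c) s' u s'' \<Longrightarrow>
     exec (While b c) s (1 + bcost b + t + u) s''"

lemma exec_deterministic:
  "exec c s t s' \<Longrightarrow> exec c s u s'' \<Longrightarrow> u = t \<and> s'' = s'"
proof (induction arbitrary: u s'' rule: exec.induct)
  case Skip
  then show ?case by (auto elim: exec.cases)
next
  case NWrite
  then show ?case by (auto elim: exec.cases)
next
  case RWrite
  then show ?case by (auto elim: exec.cases)
next
  case Roots
  from Roots.prems show ?case by (cases rule: exec.cases) (auto simp: Roots.hyps)
next
  case Seq
  from Seq.prems show ?case by (cases rule: exec.cases) (use Seq.IH in blast)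
next
  case IfTrue
  from IfTrue.prems show ?case by (cases rule: exec.cases) (use IfTrue.IH IfTrue.hyps in blast)+
next
  case IfFalse
  from IfFalse.prems show ?case by (cases rule: exec.cases) (use IfFalse.IH IfFalse.hyps in blast)+
next
  case WhileFalse
  from WhileFalse.prems show ?case by (cases rule: exec.cases) (use WhileFalse.hyps in blast)+
next
  case WhileTrue
  from WhileTrue.prems show ?case
    by (cases rule: exec.cases) (use WhileTrue.IH WhileTrue.hyps in blast)+
qed

text \<open>The input of a program computing \<^const>\<open>theta_star\<close>: the matrices \<open>D\<close> and \<open>q\<close> are stored row by
  row, and \<open>\<Omega>\<close> is enumerated by the list \<open>\<omega>\<close> of its positions. All other cells are 0.\<close>

definition store_mat :: "real mat \<Rightarrow> nat \<Rightarrow> real" where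
  "store_mat A k =
     (if k < dim_row A * dim_col A then A $$ (k div dim_col A, k mod dim_col A) else 0)"

definition input_state ::
  "nat \<Rightarrow> nat \<Rightarrow> real mat \<Rightarrow> real mat \<Rightarrow> (nat \<times> nat) list \<Rightarrow> real \<Rightarrow> real \<Rightarrow> state" where
  "input_state m n D q \<omega> \<rho> \<delta> = \<lparr>
     nats = (\<lambda>_ _. 0)(
       ''m'' := (\<lambda>_. 0)(0 := m),
       ''n'' := (\<lambda>_. 0)(0 := n),
       ''card'' := (\<lambda>_. 0)(0 := length \<omega>),
       ''row'' := (\<lambda>k. if k < length \<omega> then fst (\<omega> ! k) else 0),
       ''col'' := (\<lambda>k. if k < length \<omega> then snd (\<omega> ! k) else 0)),
     reals = (\<lambda>_ _. 0)(
       ''D'' := store_mat D,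
       ''q'' := store_mat q,
       ''rho'' := (\<lambda>_. 0)(0 := \<rho>),
       ''delta'' := (\<lambda>_. 0)(0 := \<delta>))\<rparr>"

end

theory Submission
  imports Defs
begin

text \<open>
  Completing the square with \<open>q = Lt - \<rho> Q\<close> turns the objective, up to a constant, into the separable
  convex function \<open>\<Sum> c |S| + (L - q)\<^sup>2 / (2 \<rho>)\<close>, where \<open>c\<close> is \<open>\<xi>\<close> on \<open>\<Omega>\<close> and \<open>0\<close> elsewhere; only the
  norm constraint on the residual \<open>R = L + S - proj \<Omega> D\<close> couples the entries. A feasible point
  \<open>(L', S')\<close> is optimal once there is a multiplier matrix \<open>V\<close> with \<open>L' = q + \<rho> V\<close>, with \<open>V\<close> a subgradient
  of \<open>c |.|\<close> at \<open>S'\<close>, and with \<open>-V\<close> in the normal cone of the feasible ball at the residual \<open>R'\<close>.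
  The difference of the objective values at \<open>(L, S)\<close> and \<open>(L', S')\<close> is then an explicit sum of three
  nonnegative terms, and the vanishing of each of them gives the uniqueness claims
  (\<open>optimality_criterion\<close>). If \<open>\<parallel>A\<parallel> \<le> \<delta>\<close>, the unconstrained minimizer is feasible and \<open>V = 0\<close>. If
  \<open>\<parallel>A\<parallel> > \<delta>\<close>, take \<open>V = - \<theta> R'\<close>: the two entrywise conditions say that \<open>S'\<close> is the soft threshold of
  \<open>A\<close> at \<open>\<xi> (1 + \<rho> \<theta>) / \<theta>\<close>, and then \<open>\<parallel>R'\<parallel> = phi \<theta>\<close>, so that the constraint is tight exactly when
  \<open>phi \<theta> = \<delta>\<close>. If \<open>\<delta> = 0\<close>, all feasible residuals coincide, the normal cone condition is void, and the
  threshold is \<open>\<xi> \<rho>\<close>.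

  The square of \<open>phi\<close> is a sum of terms \<open>(min (\<xi> / \<theta>) (a / (1 + \<rho> \<theta>)))\<^sup>2\<close>, one for every entry \<open>a\<close> of \<open>|A|\<close>.
  If \<open>\<parallel>A\<parallel> > \<delta> > 0\<close>, it is continuous and strictly decreasing from \<open>\<parallel>A\<parallel>\<^sup>2\<close> (the limit at \<open>0\<close>) to \<open>0\<close>, hence takes
  the value \<open>\<delta>\<^sup>2\<close> exactly once (\<open>phi_eq_ex1\<close>).

  An entry \<open>a > \<xi> \<rho>\<close> is saturated (the minimum is \<open>\<xi> / \<theta>\<close>) from its breakpoint \<open>\<xi> / (a - \<xi> \<rho>)\<close> on, and
  an entry \<open>a \<le> \<xi> \<rho>\<close> never is. Larger entries saturate earlier, so in descending order the
  saturated entries form a prefix. The program sorts the entries of \<open>|A|\<close> on \<open>\<Omega>\<close> by merging runs of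
  doubling width, which takes \<open>O(k log k)\<close> steps for \<open>k = card \<Omega>\<close>, and then scans the sorted entries for
  the first one that never saturates or whose breakpoint is not below \<open>\<theta>\<close>; the latter is the case if and
  only if \<open>phi\<close> is at most \<open>\<delta>\<close> at the breakpoint, a test that does not mention \<open>\<theta>\<close>.
  With \<open>j\<close> saturated entries and \<open>R\<close> the sum of the squares of the others, \<open>phi \<theta> = \<delta>\<close> reads
  \<open>j \<xi>\<^sup>2 / \<theta>\<^sup>2 + R / (1 + \<rho> \<theta>)\<^sup>2 = \<delta>\<^sup>2\<close>. Clearing denominators gives a quartic polynomial; the left-hand side
  decreases in \<open>\<theta>\<close>, so the quartic has exactly one positive root, which is therefore the last one in
  the list of its real roots (\<open>theta_program_correct\<close>).
\<close>

section \<open>Entrywise description of the matrix operations\<close>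

lemma finite_positions [simp]: "finite (positions m n)"
  by (simp add: positions_def)

lemma sum_squares_entries:
  assumes "A \<in> carrier_mat m n"
  shows "(fro_norm A)\<^sup>2 = (\<Sum>ij\<in>positions m n. (A $$ ij)\<^sup>2)"
  using assms by (auto simp: fro_norm_def positions_def sum_nonneg)

lemma fro_norm_nonneg: "0 \<le> fro_norm A"
  by (simp add: fro_norm_def sum_nonneg)

lemma fro_norm_le_iff:
  assumes "A \<in> carrier_mat m n" "0 \<le> \<delta>"
  shows "fro_norm A \<le> \<delta> \<longleftrightarrow> (\<Sum>ij\<in>positions m n. (A $$ ij)\<^sup>2) \<le> \<delta>\<^sup>2"
  using sum_squares_entries[OF assms(1)] fro_norm_nonneg[of A] assms(2)
  by (metis abs_le_square_iff abs_of_nonneg)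

lemma xi_pos: "0 < m \<Longrightarrow> 0 < xi m n"
  by (simp add: xi_def)

lemma pns_dataD:
  assumes "pns_data m n D Lt Q \<Omega> \<rho> \<delta>"
  shows "0 < m" "0 < n" "D \<in> carrier_mat m n" "Lt \<in> carrier_mat m n" "Q \<in> carrier_mat m n"
    "\<Omega> \<subseteq> positions m n" "0 < \<rho>" "0 \<le> \<delta>" "0 < xi m n" "q_mat \<rho> Q Lt \<in> carrier_mat m n"
  using assms by (auto simp: pns_data_def xi_pos q_mat_def)

lemma entry_simps:
  assumes "ij \<in> positions m n" "A \<in> carrier_mat m n" "B \<in> carrier_mat m n"
  shows "(A + B) $$ ij = A $$ ij + B $$ ij" "(A - B) $$ ij = A $$ ij - B $$ ij"
    "(c \<cdot>\<^sub>m A) $$ ij = c * A $$ ij" "map_mat f A $$ ij = f (A $$ ij)"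
    "(A \<odot> B) $$ ij = A $$ ij * B $$ ij"
    "max_mat A B $$ ij = max (A $$ ij) (B $$ ij)" "min_mat A B $$ ij = min (A $$ ij) (B $$ ij)"
    "proj \<Omega> A $$ ij = (if ij \<in> \<Omega> then A $$ ij else 0)"
    "ones_mat m n $$ ij = 1" "0\<^sub>m m n $$ ij = (0::real)"
  using assms
  by (cases ij; auto simp: positions_def hadamard_def max_mat_def min_mat_def proj_def ones_mat_def)+

lemma carrier_simps:
  assumes "A \<in> carrier_mat m n" "B \<in> carrier_mat m n"
  shows "A + B \<in> carrier_mat m n" "A - B \<in> carrier_mat m n" "c \<cdot>\<^sub>m A \<in> carrier_mat m n"
    "map_mat f A \<in> carrier_mat m n" "A \<odot> B \<in> carrier_mat m n" "max_mat A B \<in> carrier_mat m n"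
    "min_mat A B \<in> carrier_mat m n" "proj \<Omega> A \<in> carrier_mat m n"
  using assms by (auto simp: hadamard_def max_mat_def min_mat_def proj_def)

lemma ones_mat_carrier: "ones_mat m n \<in> carrier_mat m n"
  by (simp add: ones_mat_def)

lemma eq_mat_iff_entries:
  assumes "A \<in> carrier_mat m n" "B \<in> carrier_mat m n"
  shows "A = B \<longleftrightarrow> (\<forall>ij\<in>positions m n. A $$ ij = B $$ ij)"
  using assms by (auto simp: positions_def)

section \<open>An optimality criterion\<close>

definition weight :: "nat \<Rightarrow> nat \<Rightarrow> (nat \<times> nat) set \<Rightarrow> nat \<times> nat \<Rightarrow> real" where
  "weight m n \<Omega> ij = (if ij \<in> \<Omega> then xi m n else 0)"

lemma objective_completed_square:
  assumes data: "pns_data m n D Lt Q \<Omega> \<rho> \<delta>"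
    and L: "L \<in> carrier_mat m n" and S: "S \<in> carrier_mat m n"
  shows "pns_objective m n Lt Q \<Omega> \<rho> (L, S) =
    (\<Sum>ij\<in>positions m n. weight m n \<Omega> ij * \<bar>S $$ ij\<bar> + (L $$ ij - q_mat \<rho> Q Lt $$ ij)\<^sup>2 / (2 * \<rho>))
    - (\<Sum>ij\<in>positions m n. \<rho> / 2 * (Q $$ ij)\<^sup>2)"
proof -
  note d = pns_dataD[OF data]
  have "pns_objective m n Lt Q \<Omega> \<rho> (L, S) =
      (\<Sum>ij\<in>positions m n. xi m n * \<bar>proj \<Omega> S $$ ij\<bar> + Q $$ ij * (L - Lt) $$ ij
        + 1 / (2 * \<rho>) * ((L - Lt) $$ ij)\<^sup>2)"
    using L S d carrier_matD[OF carrier_simps(8)[OF S S]]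
    by (simp add: pns_objective_def l1_norm_def mat_inner_def sum.distrib sum_distrib_left sum_divide_distrib
        sum_squares_entries[of "L - Lt" m n] carrier_simps flip: positions_def)
  also have "\<dots> = (\<Sum>ij\<in>positions m n. weight m n \<Omega> ij * \<bar>S $$ ij\<bar>
      + (L $$ ij - q_mat \<rho> Q Lt $$ ij)\<^sup>2 / (2 * \<rho>) - \<rho> / 2 * (Q $$ ij)\<^sup>2)"
  proof (rule sum.cong)
    fix ij assume ij: "ij \<in> positions m n"
    have "q * (l - t) + 1 / (2 * \<rho>) * (l - t)\<^sup>2 = (l - (t - \<rho> * q))\<^sup>2 / (2 * \<rho>) - \<rho> / 2 * q\<^sup>2"
      for q l t :: real
      using d(7) by (simp add: field_simps power2_eq_square)
    then show "xi m n * \<bar>proj \<Omega> S $$ ij\<bar> + Q $$ ij * (L - Lt) $$ ij + 1 / (2 * \<rho>) * ((L - Lt) $$ ij)\<^sup>2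
      = weight m n \<Omega> ij * \<bar>S $$ ij\<bar> + (L $$ ij - q_mat \<rho> Q Lt $$ ij)\<^sup>2 / (2 * \<rho>) - \<rho> / 2 * (Q $$ ij)\<^sup>2"
      using ij L S d
      by (simp add: entry_simps[where m=m and n=n] carrier_simps q_mat_def weight_def)
  qed simp
  finally show ?thesis by (simp add: sum_subtractf)
qed

text \<open>
  Sufficiency of the Karush-Kuhn-Tucker conditions, with multiplier matrix \<open>V\<close>. The hypothesis
  \<open>normal\<close> says that \<open>V\<close> makes a nonnegative inner product with every change of the residual
  \<open>L + S - proj \<Omega> D\<close> that feasibility permits, with a quadratic surplus of modulus \<open>\<mu>\<close>. A positive
  \<open>\<mu>\<close> makes the residual, and hence \<open>S\<close>, unique; for \<open>\<mu> = 0\<close> the last conclusion still says that \<open>V\<close> is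
  a subgradient whose supporting line touches at \<open>S\<close> as well; if \<open>V\<close> and \<open>S'\<close> vanish on \<open>\<Omega>\<close>, so does \<open>S\<close>.
\<close>

lemma optimality_criterion:
  fixes V :: "nat \<times> nat \<Rightarrow> real"
  defines "R L S ij \<equiv> L $$ ij + S $$ ij"
  assumes data: "pns_data m n D Lt Q \<Omega> \<rho> \<delta>"
    and feas: "pns_feasible m n D \<Omega> \<delta> (L', S')"
    and stat: "\<And>ij. ij \<in> positions m n \<Longrightarrow> L' $$ ij = q_mat \<rho> Q Lt $$ ij + \<rho> * V ij"
    and subgrad: "\<And>ij x. ij \<in> positions m n \<Longrightarrow>
      weight m n \<Omega> ij * \<bar>S' $$ ij\<bar> + V ij * (x - S' $$ ij) \<le> weight m n \<Omega> ij * \<bar>x\<bar>"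
    and \<mu>: "0 \<le> \<mu>"
    and normal: "\<And>L S. pns_feasible m n D \<Omega> \<delta> (L, S) \<Longrightarrow>
      \<mu> * (\<Sum>ij\<in>positions m n. (R L S ij - R L' S' ij)\<^sup>2)
      \<le> (\<Sum>ij\<in>positions m n. V ij * (R L S ij - R L' S' ij))"
  shows "pns_optimal m n D Lt Q \<Omega> \<rho> \<delta> (L', S')"
    and "pns_optimal m n D Lt Q \<Omega> \<rho> \<delta> (L, S) \<Longrightarrow>
      L = L' \<and> (0 < \<mu> \<longrightarrow> S = S') \<and>
      (\<forall>ij\<in>positions m n. weight m n \<Omega> ij * \<bar>S $$ ij\<bar>
         = weight m n \<Omega> ij * \<bar>S' $$ ij\<bar> + V ij * (S $$ ij - S' $$ ij))"
proof -
  note d = pns_dataD[OF data]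
  let ?P = "positions m n" and ?F = "pns_objective m n Lt Q \<Omega> \<rho>"
  let ?q = "q_mat \<rho> Q Lt"
  define slack where "slack S ij = weight m n \<Omega> ij * \<bar>S $$ ij\<bar>
      - (weight m n \<Omega> ij * \<bar>S' $$ ij\<bar> + V ij * (S $$ ij - S' $$ ij))" for S ij
  have slack: "0 \<le> slack S ij" if "ij \<in> ?P" for S ij
    using subgrad[OF that] by (simp add: slack_def)
  have carr: "L' \<in> carrier_mat m n" "S' \<in> carrier_mat m n"
    using feas by (auto simp: pns_feasible_def)
  \<comment> \<open>By stationarity the linear term in \<open>L - L'\<close> joins the one in \<open>S - S'\<close> to form \<open>V\<close> times the change of the residual.\<close>
  have gap: "?F (L, S) - ?F (L', S') = (\<Sum>ij\<in>?P. slack S ij) + (\<Sum>ij\<in>?P. (L $$ ij - L' $$ ij)\<^sup>2 / (2 * \<rho>))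
      + (\<Sum>ij\<in>?P. V ij * (R L S ij - R L' S' ij))"
    if "L \<in> carrier_mat m n" "S \<in> carrier_mat m n" for L S
  proof -
    have sq: "(l - q)\<^sup>2 / (2 * \<rho>) - (q + \<rho> * v - q)\<^sup>2 / (2 * \<rho>) = (l - (q + \<rho> * v))\<^sup>2 / (2 * \<rho>) + v * (l - (q + \<rho> * v))"
      for l q v :: real
      using d(7) by (simp add: field_simps power2_eq_square)
    have "?F (L, S) - ?F (L', S') =
        (\<Sum>ij\<in>?P. (weight m n \<Omega> ij * \<bar>S $$ ij\<bar> - weight m n \<Omega> ij * \<bar>S' $$ ij\<bar>)
          + ((L $$ ij - ?q $$ ij)\<^sup>2 / (2 * \<rho>) - (L' $$ ij - ?q $$ ij)\<^sup>2 / (2 * \<rho>)))"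
      unfolding objective_completed_square[OF data that] objective_completed_square[OF data carr]
      by (simp add: sum.distrib sum_subtractf)
    also have "\<dots> = (\<Sum>ij\<in>?P. slack S ij + (L $$ ij - L' $$ ij)\<^sup>2 / (2 * \<rho>)
        + V ij * (R L S ij - R L' S' ij))"
      by (rule sum.cong) (simp_all only: stat sq slack_def R_def, simp_all add: algebra_simps)
    finally show ?thesis by (simp add: sum.distrib)
  qed
  have nonneg: "0 \<le> (\<Sum>ij\<in>?P. slack S ij)" "0 \<le> (\<Sum>ij\<in>?P. (L $$ ij - L' $$ ij)\<^sup>2 / (2 * \<rho>))"
    "0 \<le> \<mu> * (\<Sum>ij\<in>?P. (R L S ij - R L' S' ij)\<^sup>2)" for L S
    using slack d(7) \<mu> by (auto intro!: sum_nonneg mult_nonneg_nonneg)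
  have min: "?F (L', S') \<le> ?F (L, S)" if "pns_feasible m n D \<Omega> \<delta> (L, S)" for L S
    using gap[of L S] nonneg(1)[of S] nonneg(2)[of L] nonneg(3)[of L S] normal[OF that] that
    by (auto simp: pns_feasible_def)
  then show "pns_optimal m n D Lt Q \<Omega> \<rho> \<delta> (L', S')"
    using feas by (auto simp: pns_optimal_def is_arg_min_linorder)
  assume opt: "pns_optimal m n D Lt Q \<Omega> \<rho> \<delta> (L, S)"
  then have f: "pns_feasible m n D \<Omega> \<delta> (L, S)" and le: "?F (L, S) \<le> ?F (L', S')"
    using feas by (auto simp: pns_optimal_def is_arg_min_linorder)
  have c: "L \<in> carrier_mat m n" "S \<in> carrier_mat m n"
    using f by (auto simp: pns_feasible_def)
  note all = gap[OF c] nonneg(1)[of S] nonneg(2)[of L] nonneg(3)[of L S] normal[OF f] le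
  have "(\<Sum>ij\<in>?P. slack S ij) = 0" "(\<Sum>ij\<in>?P. (L $$ ij - L' $$ ij)\<^sup>2 / (2 * \<rho>)) = 0"
    "\<mu> * (\<Sum>ij\<in>?P. (R L S ij - R L' S' ij)\<^sup>2) = 0"
    using all by linarith+
  then have z: "\<forall>ij\<in>?P. slack S ij = 0" "\<forall>ij\<in>?P. L $$ ij = L' $$ ij"
    "\<mu> = 0 \<or> (\<forall>ij\<in>?P. R L S ij = R L' S' ij)"
    using slack d(7) by (auto simp: sum_nonneg_eq_0_iff)
  then show "L = L' \<and> (0 < \<mu> \<longrightarrow> S = S') \<and>
      (\<forall>ij\<in>?P. weight m n \<Omega> ij * \<bar>S $$ ij\<bar>
         = weight m n \<Omega> ij * \<bar>S' $$ ij\<bar> + V ij * (S $$ ij - S' $$ ij))"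
    using eq_mat_iff_entries[OF c(1) carr(1)] eq_mat_iff_entries[OF c(2) carr(2)]
    by (auto simp: R_def slack_def)
qed

text \<open>
  \<open>s\<close> is the minimizer of \<open>\<tau> |x| + (x - a)\<^sup>2 / 2\<close>, so \<open>a - s\<close> is a subgradient of \<open>\<tau> |.|\<close> at \<open>s\<close>. Its absolute
  value is what produces the minimum in \<^const>\<open>phi\<close>.
\<close>

lemma soft_threshold:
  fixes a \<tau> :: real
  defines "s \<equiv> sgn a * max (\<bar>a\<bar> - \<tau>) 0"
  assumes "0 \<le> \<tau>"
  shows "\<tau> * \<bar>s\<bar> + (a - s) * (x - s) \<le> \<tau> * \<bar>x\<bar>" and "\<bar>a - s\<bar> = min \<bar>a\<bar> \<tau>"
proof -
  show b: "\<bar>a - s\<bar> = min \<bar>a\<bar> \<tau>"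
    using assms(2) by (auto simp: s_def sgn_real_def max_def min_def)
  have "(a - s) * s = \<tau> * \<bar>s\<bar>"
    using assms(2) by (auto simp: s_def sgn_real_def max_def algebra_simps)
  moreover have "(a - s) * x \<le> \<tau> * \<bar>x\<bar>"
  proof -
    have "(a - s) * x \<le> \<bar>a - s\<bar> * \<bar>x\<bar>" by (metis abs_ge_self abs_mult)
    also have "\<dots> \<le> \<tau> * \<bar>x\<bar>" using b by (intro mult_right_mono) auto
    finally show ?thesis .
  qed
  ultimately show "\<tau> * \<bar>s\<bar> + (a - s) * (x - s) \<le> \<tau> * \<bar>x\<bar>"
    by (simp add: right_diff_distrib)
qed


section \<open>Entries of the closed forms\<close>

lemma S_noisy_entry:
  assumes "\<Omega> \<subseteq> positions m n" "ij \<in> positions m n" "D \<in> carrier_mat m n" "q \<in> carrier_mat m n"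
  shows "S_noisy m n D q \<Omega> \<rho> \<theta> $$ ij =
    (if ij \<in> \<Omega> then
       (if \<theta> = 0 then 0 else sgn (D $$ ij - q $$ ij) * max (\<bar>D $$ ij - q $$ ij\<bar> - xi m n * ((1 + \<rho> * \<theta>) / \<theta>)) 0)
     else - q $$ ij)"
  using assms
  by (auto simp: S_noisy_def excess_def Let_def entry_simps[where m=m and n=n] carrier_simps ones_mat_carrier)

lemma S_noisy_carrier:
  assumes "D \<in> carrier_mat m n" "q \<in> carrier_mat m n"
  shows "S_noisy m n D q \<Omega> \<rho> \<theta> \<in> carrier_mat m n"
  using assms by (auto simp: S_noisy_def excess_def Let_def carrier_simps ones_mat_carrier)

lemma L_noisy_entry:
  assumes "\<Omega> \<subseteq> positions m n" "ij \<in> positions m n" "D \<in> carrier_mat m n" "q \<in> carrier_mat m n"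
  shows "L_noisy m n D q \<Omega> \<rho> \<theta> $$ ij =
    (if ij \<in> \<Omega> then \<rho> * \<theta> / (1 + \<rho> * \<theta>) * (D $$ ij - S_noisy m n D q \<Omega> \<rho> \<theta> $$ ij) + 1 / (1 + \<rho> * \<theta>) * q $$ ij
     else q $$ ij)"
  using assms S_noisy_carrier[OF assms(3,4), of \<Omega> \<rho> \<theta>]
  by (auto simp: L_noisy_def entry_simps[where m=m and n=n] carrier_simps)

lemma L_noisy_carrier:
  assumes "D \<in> carrier_mat m n" "q \<in> carrier_mat m n"
  shows "L_noisy m n D q \<Omega> \<rho> \<theta> \<in> carrier_mat m n"
  using assms S_noisy_carrier[OF assms, of \<Omega> \<rho> \<theta>] by (auto simp: L_noisy_def carrier_simps)

lemma S_exact_entry: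
  assumes "\<Omega> \<subseteq> positions m n" "ij \<in> positions m n" "D \<in> carrier_mat m n" "q \<in> carrier_mat m n"
  shows "S_exact m n D q \<Omega> \<rho> $$ ij =
    (if ij \<in> \<Omega> then sgn (D $$ ij - q $$ ij) * max (\<bar>D $$ ij - q $$ ij\<bar> - xi m n * \<rho>) 0
     else - q $$ ij)"
  using assms
  by (auto simp: S_exact_def excess_def Let_def entry_simps[where m=m and n=n] carrier_simps ones_mat_carrier)

lemma S_exact_carrier:
  assumes "D \<in> carrier_mat m n" "q \<in> carrier_mat m n"
  shows "S_exact m n D q \<Omega> \<rho> \<in> carrier_mat m n"
  using assms by (auto simp: S_exact_def excess_def Let_def carrier_simps ones_mat_carrier)

section \<open>The equation for theta\<close>

text \<open>
  The contribution of an entry \<open>a\<close> of \<open>|A|\<close> to the square of \<^const>\<open>phi\<close>, for \<open>c = \<xi>\<close> and \<open>r = \<rho>\<close>.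
\<close>

definition clipped_square :: "real \<Rightarrow> real \<Rightarrow> real \<Rightarrow> real \<Rightarrow> real" where
  "clipped_square c r \<theta> a = (min (c / \<theta>) (a / (1 + r * \<theta>)))\<^sup>2"

lemma phi_squared:
  assumes "A \<in> carrier_mat m n"
  shows "(phi m n \<rho> A \<theta>)\<^sup>2 = (\<Sum>ij\<in>positions m n. clipped_square (xi m n) \<rho> \<theta> \<bar>A $$ ij\<bar>)"
  using assms
  by (simp add: phi_def sum_squares_entries[where m=m and n=n] carrier_simps ones_mat_carrier
      entry_simps[where m=m and n=n] clipped_square_def)

lemma clipped_mono:
  assumes "0 < \<theta>" "\<theta> \<le> \<theta>'" "0 \<le> a" "0 < c" "0 < r"
  shows "clipped_square c r \<theta>' a \<le> clipped_square c r \<theta> a"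
  unfolding clipped_square_def
proof (rule power_mono)
  have p: "0 < (1 + r * \<theta>') * (1 + r * \<theta>)" "1 + r * \<theta> \<le> 1 + r * \<theta>'"
    using assms by (auto intro!: add_pos_pos mult_pos_pos)
  have "c / \<theta>' \<le> c / \<theta>" using assms by (intro divide_left_mono) auto
  moreover have "a / (1 + r * \<theta>') \<le> a / (1 + r * \<theta>)"
    by (rule divide_left_mono[OF p(2) assms(3) p(1)])
  ultimately show "min (c / \<theta>') (a / (1 + r * \<theta>')) \<le> min (c / \<theta>) (a / (1 + r * \<theta>))"
    by (rule min.mono)
  show "0 \<le> min (c / \<theta>') (a / (1 + r * \<theta>'))"
    using assms by simp
qed

lemma clipped_strict_mono:
  assumes "0 < \<theta>" "\<theta> < \<theta>'" "0 < a" "0 < c" "0 < r"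
  shows "clipped_square c r \<theta>' a < clipped_square c r \<theta> a"
  unfolding clipped_square_def
proof (rule power_strict_mono)
  have p: "0 < (1 + r * \<theta>') * (1 + r * \<theta>)" "1 + r * \<theta> < 1 + r * \<theta>'"
    using assms by (auto intro!: add_pos_pos mult_pos_pos)
  have "c / \<theta>' < c / \<theta>" using assms by (intro divide_strict_left_mono) auto
  moreover have "a / (1 + r * \<theta>') < a / (1 + r * \<theta>)"
    by (rule divide_strict_left_mono[OF p(2) assms(3) p(1)])
  ultimately show "min (c / \<theta>') (a / (1 + r * \<theta>')) < min (c / \<theta>) (a / (1 + r * \<theta>))"
    by (auto simp: min_less_iff_disj)
  show "0 \<le> min (c / \<theta>') (a / (1 + r * \<theta>'))"
    using assms by simp
qed simp

lemma clipped_sum_strict_mono: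
  assumes "finite I" "\<And>i. i \<in> I \<Longrightarrow> 0 \<le> a i" "0 < (\<Sum>i\<in>I. (a i)\<^sup>2)" "0 < \<theta>" "\<theta> < \<theta>'" "0 < c" "0 < r"
  shows "(\<Sum>i\<in>I. clipped_square c r \<theta>' (a i)) < (\<Sum>i\<in>I. clipped_square c r \<theta> (a i))"
proof (rule sum_strict_mono_ex1)
  show "\<forall>i\<in>I. clipped_square c r \<theta>' (a i) \<le> clipped_square c r \<theta> (a i)"
    using assms by (auto intro!: clipped_mono)
  have "\<not> (\<forall>i\<in>I. a i = 0)"
    using assms(3) by force
  then obtain i where "i \<in> I" "a i \<noteq> 0" by blast
  moreover from this have "0 < a i" using assms(2)[of i] by linarith
  ultimately show "\<exists>i\<in>I. clipped_square c r \<theta>' (a i) < clipped_square c r \<theta> (a i)"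
    using assms by (auto intro!: clipped_strict_mono bexI[of _ i])
qed (use assms in auto)

text \<open>
  The sum is strictly decreasing, so only the intermediate values have to be produced. Near \<open>0\<close> every
  term is \<open>(a i / (1 + r \<theta>))\<^sup>2\<close>, and these add up to more than \<open>\<delta>\<close> by continuity at \<open>0\<close>; for large \<open>\<theta>\<close> the
  bound \<open>(c / \<theta>)\<^sup>2\<close> on every term takes the sum below \<open>\<delta>\<close>.
\<close>

lemma clipped_sum_eq_ex1:
  assumes fin: "finite I" and a: "\<And>i. i \<in> I \<Longrightarrow> 0 \<le> a i" and pos: "0 < \<delta>" "0 < c" "0 < r"
    and big: "\<delta> < (\<Sum>i\<in>I. (a i)\<^sup>2)"
  shows "\<exists>!\<theta>. 0 < \<theta> \<and> (\<Sum>i\<in>I. clipped_square c r \<theta> (a i)) = \<delta>"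
proof -
  define g where "g \<theta> = (\<Sum>i\<in>I. clipped_square c r \<theta> (a i))" for \<theta>
  define M where "M = 1 + (\<Sum>i\<in>I. a i)"
  have M: "0 < M" "a i \<le> M" if "i \<in> I" for i
    using member_le_sum[of i I a] fin a that by (auto simp: M_def add_pos_nonneg sum_nonneg)
  have M1: "0 < M" unfolding M_def using a by (simp add: add_pos_nonneg sum_nonneg)
  have strict: "g \<theta>' < g \<theta>" if "0 < \<theta>" "\<theta> < \<theta>'" for \<theta> \<theta>'
    unfolding g_def by (rule clipped_sum_strict_mono) (use assms that in auto)
  have "((\<lambda>\<theta>. (\<Sum>i\<in>I. (a i)\<^sup>2) / (1 + r * \<theta>)\<^sup>2) \<longlongrightarrow> (\<Sum>i\<in>I. (a i)\<^sup>2) / (1 + r * 0)\<^sup>2) (at_right 0)"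
    by (intro tendsto_intros) auto
  then have "\<forall>\<^sub>F \<theta> in at_right 0. \<delta> < (\<Sum>i\<in>I. (a i)\<^sup>2) / (1 + r * \<theta>)\<^sup>2"
    using big by (intro order_tendstoD(1)) auto
  moreover have "\<forall>\<^sub>F \<theta> in at_right 0. \<theta> \<in> {0<..<c / M}"
    using pos M1 by (intro eventually_at_right_real) auto
  ultimately have "\<forall>\<^sub>F \<theta> in at_right (0::real). 0 < \<theta> \<and> \<theta> < c / M \<and> \<delta> < (\<Sum>i\<in>I. (a i)\<^sup>2) / (1 + r * \<theta>)\<^sup>2"
    by eventually_elim auto
  then obtain lo where lo: "0 < lo" "lo < c / M" "\<delta> < (\<Sum>i\<in>I. (a i)\<^sup>2) / (1 + r * lo)\<^sup>2"
    using eventually_happens trivial_limit_at_right_real by blast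
  have "a i / (1 + r * lo) \<le> c / lo" if "i \<in> I" for i
  proof -
    have "a i / (1 + r * lo) \<le> a i / 1"
      using lo(1) pos a[OF that] by (intro divide_left_mono) (auto simp: add_pos_pos)
    also have "\<dots> \<le> M" using M(2)[OF that] by simp
    also have "\<dots> \<le> c / lo" using lo M1 by (simp add: field_simps)
    finally show ?thesis .
  qed
  then have "g lo = (\<Sum>i\<in>I. (a i)\<^sup>2) / (1 + r * lo)\<^sup>2"
    unfolding g_def sum_divide_distrib
    by (intro sum.cong) (auto simp: clipped_square_def min_absorb2 power_divide)
  then have glo: "\<delta> < g lo" using lo by simp
  define N where "N = real (card I)"
  \<comment> \<open>Here \<open>(c / hi)\<^sup>2 = \<delta> / (N + 1)\<^sup>2\<close>, and \<open>N\<close> such terms add up to at most \<open>\<delta>\<close>.\<close>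
  define hi where "hi = c * (N + 1) / sqrt \<delta>"
  have hi: "0 < hi" using pos by (auto simp: hi_def N_def intro!: divide_pos_pos mult_pos_pos)
  have "g hi \<le> (\<Sum>i\<in>I. (c / hi)\<^sup>2)"
    unfolding g_def clipped_square_def
    using hi a pos by (intro sum_mono power_mono) auto
  also have "\<dots> = N * \<delta> / (N + 1)\<^sup>2"
    using pos by (simp add: hi_def N_def power_divide power_mult_distrib)
  also have "\<dots> \<le> \<delta>"
  proof -
    have "N \<le> (N + 1)\<^sup>2" "0 < (N + 1)\<^sup>2" by (simp_all add: N_def power2_eq_square algebra_simps add_pos_nonneg)
    then show ?thesis using pos by (simp add: divide_le_eq mult.commute)
  qed
  finally have ghi: "g hi \<le> \<delta>" .
  have "lo < hi" using strict[OF hi, of lo] glo ghi by (cases lo hi rule: linorder_cases) auto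
  moreover have "continuous_on {lo..hi} g"
    unfolding g_def clipped_square_def using lo(1) pos
    by (intro continuous_intros) (auto simp: add_pos_pos, smt (verit) mult_nonneg_nonneg)
  ultimately obtain \<theta> where "lo \<le> \<theta>" "g \<theta> = \<delta>"
    using IVT2'[of g hi \<delta> lo] glo ghi by auto
  then have "0 < \<theta> \<and> g \<theta> = \<delta>" using lo by simp
  moreover have "\<theta>' = \<theta>" if "0 < \<theta>' \<and> g \<theta>' = \<delta>" for \<theta>'
    using that strict \<open>0 < \<theta> \<and> g \<theta> = \<delta>\<close> by (metis less_irrefl linorder_neqE)
  ultimately show ?thesis unfolding g_def by blast
qed

lemma phi_eq_ex1:
  assumes "A \<in> carrier_mat m n" "0 < m" "0 < \<rho>" "0 < \<delta>" "\<not> fro_norm A \<le> \<delta>"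
  shows "\<exists>!\<theta>. 0 < \<theta> \<and> phi m n \<rho> A \<theta> = \<delta>"
proof -
  have "phi m n \<rho> A \<theta> = \<delta> \<longleftrightarrow> (\<Sum>ij\<in>positions m n. clipped_square (xi m n) \<rho> \<theta> \<bar>A $$ ij\<bar>) = \<delta>\<^sup>2" for \<theta>
    unfolding phi_squared[OF assms(1), symmetric]
    using assms(4) by (simp add: phi_def fro_norm_nonneg)
  moreover have "\<delta>\<^sup>2 < (\<Sum>ij\<in>positions m n. \<bar>A $$ ij\<bar>\<^sup>2)"
    using fro_norm_le_iff[OF assms(1), of \<delta>] assms by simp
  then have "\<exists>!\<theta>. 0 < \<theta> \<and> (\<Sum>ij\<in>positions m n. clipped_square (xi m n) \<rho> \<theta> \<bar>A $$ ij\<bar>) = \<delta>\<^sup>2"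
    using assms xi_pos[of m n] by (intro clipped_sum_eq_ex1) auto
  ultimately show ?thesis by simp
qed

section \<open>Optimality of the closed forms\<close>

text \<open>
  The constraint is active, with Lagrange multiplier \<open>\<theta>\<close>: the multiplier matrix is \<open>- \<theta> R'\<close> for the
  residual \<open>R'\<close>. The identity \<open>- \<langle>R', R - R'\<rangle> = (\<parallel>R - R'\<parallel>\<^sup>2 + \<parallel>R'\<parallel>\<^sup>2 - \<parallel>R\<parallel>\<^sup>2) / 2\<close> together with
  \<open>\<parallel>R\<parallel> \<le> \<delta> = \<parallel>R'\<parallel>\<close> gives the normal cone condition with modulus \<open>\<theta> / 2\<close>.
\<close>

lemma noisy_optimal_active:
  assumes data: "pns_data m n D Lt Q \<Omega> \<rho> \<delta>" and "0 < \<delta>"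
  defines "q \<equiv> q_mat \<rho> Q Lt"
  defines "A \<equiv> proj \<Omega> (D - q)"
  assumes \<theta>: "0 < \<theta>" "phi m n \<rho> A \<theta> = \<delta>"
  defines "S' \<equiv> S_noisy m n D q \<Omega> \<rho> \<theta>" and "L' \<equiv> L_noisy m n D q \<Omega> \<rho> \<theta>"
  shows "pns_optimal m n D Lt Q \<Omega> \<rho> \<delta> (L', S')"
    and "pns_optimal m n D Lt Q \<Omega> \<rho> \<delta> (L, S) \<Longrightarrow> L = L' \<and> S = S'"
proof -
  note d = pns_dataD[OF data, folded q_def]
  let ?P = "positions m n"
  define \<sigma> where "\<sigma> = 1 + \<rho> * \<theta>"
  have \<sigma>: "0 < \<sigma>" using d(7) \<theta>(1) by (simp add: \<sigma>_def add_pos_pos)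
  define \<tau> where "\<tau> = xi m n * (\<sigma> / \<theta>)"
  have \<tau>: "0 \<le> \<tau>" "\<theta> / \<sigma> * \<tau> = xi m n" "\<tau> / \<sigma> = xi m n / \<theta>"
    using d(9) \<theta>(1) \<sigma> by (auto simp: \<tau>_def)
  have carr: "A \<in> carrier_mat m n" "S' \<in> carrier_mat m n" "L' \<in> carrier_mat m n"
    using d by (auto simp: A_def S'_def L'_def carrier_simps S_noisy_carrier L_noisy_carrier)
  have Sij: "S' $$ ij = (if ij \<in> \<Omega> then sgn (A $$ ij) * max (\<bar>A $$ ij\<bar> - \<tau>) 0 else - q $$ ij)"
    and Aij: "A $$ ij = (if ij \<in> \<Omega> then D $$ ij - q $$ ij else 0)" if "ij \<in> ?P" for ij
    using that d \<theta>(1)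
    by (auto simp: S'_def A_def S_noisy_entry entry_simps[where m=m and n=n] carrier_simps \<tau>_def \<sigma>_def)
  define r where "r ij = L' $$ ij + S' $$ ij - proj \<Omega> D $$ ij" for ij
  have Lij: "L' $$ ij = (if ij \<in> \<Omega> then \<rho> * \<theta> / \<sigma> * (D $$ ij - S' $$ ij) + 1 / \<sigma> * q $$ ij else q $$ ij)"
    if "ij \<in> ?P" for ij
    using that d by (simp add: L'_def S'_def L_noisy_entry \<sigma>_def)
  have rij: "r ij = (if ij \<in> \<Omega> then (S' $$ ij - A $$ ij) / \<sigma> else 0)" if "ij \<in> ?P" for ij
  proof -
    have "\<rho> * \<theta> / \<sigma> * (x - s) + 1 / \<sigma> * y + s - x = (s - (x - y)) / \<sigma>" for x y s :: real
      using \<sigma> by (simp add: field_simps) (simp add: \<sigma>_def algebra_simps)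
    then show ?thesis
      using that d Sij[OF that] by (simp add: r_def Lij Aij entry_simps[where m=m and n=n])
  qed
  \<comment> \<open>The residual has norm \<open>phi \<theta>\<close>, so the constraint holds with equality.\<close>
  have rsq: "(\<Sum>ij\<in>?P. (r ij)\<^sup>2) = \<delta>\<^sup>2"
  proof -
    have "(r ij)\<^sup>2 = clipped_square (xi m n) \<rho> \<theta> \<bar>A $$ ij\<bar>" if "ij \<in> ?P" for ij
    proof (cases "ij \<in> \<Omega>")
      case True
      then have "\<bar>r ij\<bar> = min \<bar>A $$ ij\<bar> \<tau> / \<sigma>"
        using soft_threshold(2)[OF \<tau>(1), of "A $$ ij"] Sij[OF that] rij[OF that] \<sigma>
        by (simp add: abs_minus_commute)
      also have "\<dots> = min (xi m n / \<theta>) (\<bar>A $$ ij\<bar> / \<sigma>)"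
        using \<sigma> \<tau>(3) by (simp add: min_divide_distrib_right min.commute)
      finally show ?thesis by (metis \<sigma>_def clipped_square_def power2_abs)
    next
      case False
      then show ?thesis using that \<theta>(1) d(9) by (simp add: rij clipped_square_def Aij)
    qed
    then show ?thesis using phi_squared[OF carr(1), of \<rho> \<theta>] \<theta>(2) by simp
  qed
  have R: "(fro_norm (L + S - proj \<Omega> D))\<^sup>2 = (\<Sum>ij\<in>?P. (L $$ ij + S $$ ij - proj \<Omega> D $$ ij)\<^sup>2)"
    if "L \<in> carrier_mat m n" "S \<in> carrier_mat m n" for L S
    using that d by (simp add: sum_squares_entries[where m=m and n=n] carrier_simps entry_simps(1,2)[where m=m and n=n])
  have feas: "pns_feasible m n D \<Omega> \<delta> (L', S')"
    using R[OF carr(3,2)] rsq carr \<open>0 < \<delta>\<close> fro_norm_nonneg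
    by (auto simp: pns_feasible_def r_def power2_eq_iff_nonneg)
  have 1: "L' $$ ij = q_mat \<rho> Q Lt $$ ij + \<rho> * (- \<theta> * r ij)" if "ij \<in> ?P" for ij
  proof -
    have "\<rho> * \<theta> / \<sigma> * (x - s) + 1 / \<sigma> * y = y + \<rho> * (- \<theta> * ((s - (x - y)) / \<sigma>))" for x y s :: real
      using \<sigma> by (simp add: field_simps) (simp add: \<sigma>_def algebra_simps)
    then show ?thesis
      using that by (simp add: rij Aij Lij flip: q_def)
  qed
  have 2: "weight m n \<Omega> ij * \<bar>S' $$ ij\<bar> + - \<theta> * r ij * (x - S' $$ ij) \<le> weight m n \<Omega> ij * \<bar>x\<bar>"
    if "ij \<in> ?P" for ij x
  proof (cases "ij \<in> \<Omega>")
    case True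
    have "\<theta> / \<sigma> * (\<tau> * \<bar>S' $$ ij\<bar> + (A $$ ij - S' $$ ij) * (x - S' $$ ij)) \<le> \<theta> / \<sigma> * (\<tau> * \<bar>x\<bar>)"
      using soft_threshold(1)[OF \<tau>(1), of "A $$ ij" x] Sij[OF that] True \<theta>(1) \<sigma>
      by (intro mult_left_mono) auto
    moreover have "\<theta> / \<sigma> * (\<tau> * y + z) = xi m n * y + \<theta> / \<sigma> * z" "\<theta> / \<sigma> * (\<tau> * y) = xi m n * y" for y z
      using \<tau>(2) by (simp_all add: distrib_left flip: mult.assoc)
    ultimately have "xi m n * \<bar>S' $$ ij\<bar> + \<theta> / \<sigma> * ((A $$ ij - S' $$ ij) * (x - S' $$ ij)) \<le> xi m n * \<bar>x\<bar>"
      by simp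
    moreover have "- \<theta> * ((s - a) / \<sigma>) * (x - s) = \<theta> / \<sigma> * ((a - s) * (x - s))" for a s
      by (simp add: algebra_simps diff_divide_distrib)
    ultimately show ?thesis
      using True that by (simp only: weight_def rij if_True)
  next
    case False
    then show ?thesis using that by (simp add: weight_def rij)
  qed
  have 3: "\<theta> / 2 * (\<Sum>ij\<in>?P. (L $$ ij + S $$ ij - (L' $$ ij + S' $$ ij))\<^sup>2)
      \<le> (\<Sum>ij\<in>?P. - \<theta> * r ij * (L $$ ij + S $$ ij - (L' $$ ij + S' $$ ij)))"
    if f: "pns_feasible m n D \<Omega> \<delta> (L, S)" for L S
  proof -
    define e where "e ij = L $$ ij + S $$ ij - proj \<Omega> D $$ ij" for ij
    have "(\<Sum>ij\<in>?P. (e ij)\<^sup>2) \<le> \<delta>\<^sup>2"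
      using f R[of L S] d(8) fro_norm_nonneg
      by (auto simp: pns_feasible_def e_def intro!: power_mono simp flip: R)
    then have "\<theta> / 2 * ((\<Sum>ij\<in>?P. (e ij)\<^sup>2) - (\<Sum>ij\<in>?P. (r ij)\<^sup>2)) \<le> 0"
      using \<theta>(1) by (simp add: rsq mult_nonneg_nonpos)
    also have "\<theta> / 2 * ((\<Sum>ij\<in>?P. (e ij)\<^sup>2) - (\<Sum>ij\<in>?P. (r ij)\<^sup>2)) =
        (\<Sum>ij\<in>?P. \<theta> / 2 * (e ij - r ij)\<^sup>2 - (- \<theta> * r ij * (e ij - r ij)))"
      unfolding sum_subtractf[symmetric] sum_distrib_left
      by (rule sum.cong) (auto simp: field_simps power2_eq_square)
    finally have "\<theta> / 2 * (\<Sum>ij\<in>?P. (e ij - r ij)\<^sup>2) \<le> (\<Sum>ij\<in>?P. - \<theta> * r ij * (e ij - r ij))"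
      unfolding sum_subtractf by (simp only: sum_distrib_left)
    moreover have "L $$ ij + S $$ ij - (L' $$ ij + S' $$ ij) = e ij - r ij" for ij
      by (simp add: e_def r_def)
    ultimately show ?thesis by simp
  qed
  have mu: "0 \<le> \<theta> / 2" using \<theta>(1) by simp
  show "pns_optimal m n D Lt Q \<Omega> \<rho> \<delta> (L', S')"
    by (rule optimality_criterion(1)[OF data feas 1 2 mu 3])
  show "L = L' \<and> S = S'" if "pns_optimal m n D Lt Q \<Omega> \<rho> \<delta> (L, S)"
    using optimality_criterion(2)[OF data feas 1 2 mu 3 that] \<theta>(1) by simp
qed

text \<open>
  Here \<open>L = q\<close> and \<open>S = 0\<close> on \<open>\<Omega>\<close> minimize both parts of the objective separately, and the multiplier
  matrix vanishes. Off \<open>\<Omega>\<close> the objective ignores \<open>S\<close>, and the constraint determines it only when the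
  entries on \<open>\<Omega>\<close> already use up the whole radius, that is, when \<open>\<parallel>A\<parallel> = \<delta>\<close>.
\<close>

lemma noisy_optimal_inactive:
  assumes data: "pns_data m n D Lt Q \<Omega> \<rho> \<delta>"
  defines "q \<equiv> q_mat \<rho> Q Lt"
  defines "A \<equiv> proj \<Omega> (D - q)"
  assumes small: "fro_norm A \<le> \<delta>"
  defines "S' \<equiv> S_noisy m n D q \<Omega> \<rho> 0" and "L' \<equiv> L_noisy m n D q \<Omega> \<rho> 0"
  shows "pns_optimal m n D Lt Q \<Omega> \<rho> \<delta> (L', S')"
    and "pns_optimal m n D Lt Q \<Omega> \<rho> \<delta> (L, S) \<Longrightarrow> L = L' \<and> proj \<Omega> S = proj \<Omega> S' \<and>
      (\<delta> \<le> fro_norm A \<or> \<Omega> = positions m n \<longrightarrow> S = S')"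
proof -
  note d = pns_dataD[OF data, folded q_def]
  let ?P = "positions m n"
  have carr: "A \<in> carrier_mat m n" "S' \<in> carrier_mat m n" "L' \<in> carrier_mat m n"
    using d by (auto simp: A_def S'_def L'_def carrier_simps S_noisy_carrier L_noisy_carrier)
  have Sij: "S' $$ ij = (if ij \<in> \<Omega> then 0 else - q $$ ij)" and Lij: "L' $$ ij = q $$ ij"
    and Aij: "A $$ ij = (if ij \<in> \<Omega> then D $$ ij - q $$ ij else 0)" if "ij \<in> ?P" for ij
    using that d
    by (auto simp: S'_def L'_def A_def S_noisy_entry L_noisy_entry entry_simps[where m=m and n=n] carrier_simps)
  have R: "(fro_norm (L + S - proj \<Omega> D))\<^sup>2 = (\<Sum>ij\<in>?P. (L $$ ij + S $$ ij - proj \<Omega> D $$ ij)\<^sup>2)"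
    if "L \<in> carrier_mat m n" "S \<in> carrier_mat m n" for L S
    using that d by (simp add: sum_squares_entries[where m=m and n=n] carrier_simps entry_simps(1,2)[where m=m and n=n])
  have "(fro_norm (L' + S' - proj \<Omega> D))\<^sup>2 = (fro_norm A)\<^sup>2"
    unfolding R[OF carr(3,2)] sum_squares_entries[OF carr(1)]
    using d by (intro sum.cong) (auto simp: Sij Lij Aij entry_simps[where m=m and n=n] power2_commute)
  then have feas: "pns_feasible m n D \<Omega> \<delta> (L', S')"
    using small carr fro_norm_nonneg by (auto simp: pns_feasible_def power2_eq_iff_nonneg)
  have crit: "L' $$ ij = q_mat \<rho> Q Lt $$ ij + \<rho> * 0"
    "weight m n \<Omega> ij * \<bar>S' $$ ij\<bar> + 0 * (x - S' $$ ij) \<le> weight m n \<Omega> ij * \<bar>x\<bar>"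
    if "ij \<in> ?P" for ij x
    using that d(9) by (auto simp: Lij Sij weight_def simp flip: q_def)
  note opt = optimality_criterion[OF data feas crit(1) crit(2) order_refl]
  show "pns_optimal m n D Lt Q \<Omega> \<rho> \<delta> (L', S')"
    by (rule opt(1)) auto
  assume o: "pns_optimal m n D Lt Q \<Omega> \<rho> \<delta> (L, S)"
  then have f: "fro_norm (L + S - proj \<Omega> D) \<le> \<delta>" "L \<in> carrier_mat m n" "S \<in> carrier_mat m n"
    by (auto simp: pns_optimal_def is_arg_min_def pns_feasible_def)
  have L: "L = L'" and w: "\<forall>ij\<in>?P. weight m n \<Omega> ij * \<bar>S $$ ij\<bar> = weight m n \<Omega> ij * \<bar>S' $$ ij\<bar>"
    using opt(2)[OF _ _ _ o] by auto
  have S0: "S $$ ij = 0" if "ij \<in> \<Omega>" for ij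
  proof -
    have "ij \<in> ?P" using that d(6) by blast
    then show ?thesis using w that d(9) Sij by (auto simp: weight_def)
  qed
  have "proj \<Omega> S = proj \<Omega> S'"
    using f carr S0 Sij by (subst eq_mat_iff_entries[where m=m and n=n]) (auto simp: carrier_simps entry_simps[where m=m and n=n])
  moreover have "S = S'" if "\<delta> \<le> fro_norm A \<or> \<Omega> = ?P"
  proof -
    have "S $$ ij = S' $$ ij" if ij: "ij \<in> ?P" "ij \<notin> \<Omega>" for ij
    proof -
      have "\<delta> = fro_norm A" using \<open>\<delta> \<le> fro_norm A \<or> \<Omega> = ?P\<close> ij small by auto
      then have "(fro_norm (L + S - proj \<Omega> D))\<^sup>2 \<le> (fro_norm A)\<^sup>2"
        using f(1) by (intro power_mono fro_norm_nonneg) auto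
      moreover have "(fro_norm (L + S - proj \<Omega> D))\<^sup>2 - (fro_norm A)\<^sup>2
          = (\<Sum>ij\<in>?P. if ij \<in> \<Omega> then 0 else (q $$ ij + S $$ ij)\<^sup>2)"
        unfolding R[OF f(2,3)] sum_squares_entries[OF carr(1)] sum_subtractf[symmetric]
        using d by (intro sum.cong) (auto simp: L S0 Lij Aij entry_simps[where m=m and n=n] power2_commute)
      ultimately have "(\<Sum>ij\<in>?P. if ij \<in> \<Omega> then 0 else (q $$ ij + S $$ ij)\<^sup>2) \<le> 0" by simp
      then have "(\<Sum>ij\<in>?P. if ij \<in> \<Omega> then 0 else (q $$ ij + S $$ ij)\<^sup>2) = 0"
        by (intro antisym sum_nonneg) auto
      then have "(if ij \<in> \<Omega> then 0 else (q $$ ij + S $$ ij)\<^sup>2) = 0"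
        using ij by (subst (asm) sum_nonneg_eq_0_iff) auto
      then show ?thesis using ij by (simp add: Sij)
    qed
    then show ?thesis
      using S0 Sij by (subst eq_mat_iff_entries[OF f(3) carr(2)]) auto
  qed
  ultimately show "L = L' \<and> proj \<Omega> S = proj \<Omega> S' \<and> (\<delta> \<le> fro_norm A \<or> \<Omega> = ?P \<longrightarrow> S = S')"
    using L by blast
qed

text \<open>
  For \<open>\<delta> = 0\<close> every feasible pair satisfies \<open>L + S = proj \<Omega> D\<close>, so \<open>normal\<close> holds for any multiplier
  and any modulus; the multiplier is read off from stationarity.
\<close>

lemma exact_optimal:
  assumes data: "pns_data m n D Lt Q \<Omega> \<rho> 0"
  defines "q \<equiv> q_mat \<rho> Q Lt"
  defines "S' \<equiv> S_exact m n D q \<Omega> \<rho>" and "L' \<equiv> L_exact m n D q \<Omega> \<rho>"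
  shows "pns_optimal m n D Lt Q \<Omega> \<rho> 0 (L', S')"
    and "pns_optimal m n D Lt Q \<Omega> \<rho> 0 (L, S) \<Longrightarrow> L = L' \<and> S = S'"
proof -
  note d = pns_dataD[OF data, folded q_def]
  let ?P = "positions m n"
  define A where "A ij = (if ij \<in> \<Omega> then D $$ ij - q $$ ij else - q $$ ij)" for ij
  have carr: "S' \<in> carrier_mat m n" "L' \<in> carrier_mat m n"
    using d by (auto simp: S'_def L'_def L_exact_def carrier_simps S_exact_carrier)
  have Sij: "S' $$ ij = (if ij \<in> \<Omega> then sgn (A ij) * max (\<bar>A ij\<bar> - xi m n * \<rho>) 0 else A ij)"
    and Lij: "L' $$ ij = proj \<Omega> D $$ ij - S' $$ ij" if "ij \<in> ?P" for ij
    using that d carr(1) by (auto simp: S'_def L'_def L_exact_def S_exact_entry S_exact_carrier A_def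
        entry_simps(2)[where m=m and n=n] carrier_simps)
  define v where "v ij = (A ij - S' $$ ij) / \<rho>" for ij
  have R: "L $$ ij + S $$ ij = proj \<Omega> D $$ ij" if "pns_feasible m n D \<Omega> 0 (L, S)" "ij \<in> ?P" for L S ij
  proof -
    have "L + S - proj \<Omega> D \<in> carrier_mat m n" "fro_norm (L + S - proj \<Omega> D) \<le> 0"
      using that d by (auto simp: pns_feasible_def carrier_simps)
    then have "(\<Sum>ij\<in>?P. ((L + S - proj \<Omega> D) $$ ij)\<^sup>2) \<le> 0"
      using fro_norm_le_iff[of _ m n 0] by simp
    then have "(\<Sum>ij\<in>?P. ((L + S - proj \<Omega> D) $$ ij)\<^sup>2) = 0"
      by (intro antisym sum_nonneg) auto
    then have "((L + S - proj \<Omega> D) $$ ij)\<^sup>2 = 0"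
      using that(2) by (subst (asm) sum_nonneg_eq_0_iff) auto
    then show ?thesis using that d by (simp add: pns_feasible_def carrier_simps entry_simps(1,2)[where m=m and n=n])
  qed
  have feas: "pns_feasible m n D \<Omega> 0 (L', S')"
    using carr d fro_norm_le_iff[of "L' + S' - proj \<Omega> D" m n 0]
    by (simp add: pns_feasible_def carrier_simps entry_simps(1,2)[where m=m and n=n] Lij)
  have 1: "L' $$ ij = q_mat \<rho> Q Lt $$ ij + \<rho> * v ij" if "ij \<in> ?P" for ij
    using that d by (simp add: Lij v_def A_def entry_simps[where m=m and n=n] flip: q_def)
  have 2: "weight m n \<Omega> ij * \<bar>S' $$ ij\<bar> + v ij * (x - S' $$ ij) \<le> weight m n \<Omega> ij * \<bar>x\<bar>"
    if "ij \<in> ?P" for ij x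
  proof (cases "ij \<in> \<Omega>")
    case True
    have "xi m n * \<rho> * \<bar>S' $$ ij\<bar> + (A ij - S' $$ ij) * (x - S' $$ ij) \<le> xi m n * \<rho> * \<bar>x\<bar>"
      using soft_threshold(1)[of "xi m n * \<rho>" "A ij" x] Sij[OF that] True d(7,9) by simp
    then show ?thesis using True d(7) by (simp add: weight_def v_def field_simps)
  next
    case False
    then show ?thesis using that by (simp add: weight_def v_def Sij)
  qed
  \<comment> \<open>Both sides vanish; the modulus \<open>1\<close> is an arbitrary positive number.\<close>
  have 3: "1 * (\<Sum>ij\<in>?P. (L $$ ij + S $$ ij - (L' $$ ij + S' $$ ij))\<^sup>2)
      \<le> (\<Sum>ij\<in>?P. v ij * (L $$ ij + S $$ ij - (L' $$ ij + S' $$ ij)))"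
    if "pns_feasible m n D \<Omega> 0 (L, S)" for L S
    using R[OF that] R[OF feas] by simp
  show "pns_optimal m n D Lt Q \<Omega> \<rho> 0 (L', S')"
    by (rule optimality_criterion(1)[OF data feas 1 2 zero_le_one 3])
  show "L = L' \<and> S = S'" if "pns_optimal m n D Lt Q \<Omega> \<rho> 0 (L, S)"
    using optimality_criterion(2)[OF data feas 1 2 zero_le_one 3 that] by simp
qed


section \<open>Reasoning about programs and their cost\<close>

text \<open>
  Programs without loops are executed by the simplifier through \<open>run\<close> instead of the rules of
  \<^const>\<open>exec\<close>. The values of \<open>run\<close> and \<open>max_cost\<close> on loops are dummies.
\<close>

primrec loop_free :: "com \<Rightarrow> bool" where
  "loop_free SKIP = True"
| "loop_free (NWrite x e f) = True"
| "loop_free (RWrite x e f) = True"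
| "loop_free (Roots x y a0 a1 a2 a3 a4) = True"
| "loop_free (Seq c d) = (loop_free c \<and> loop_free d)"
| "loop_free (If b c d) = (loop_free c \<and> loop_free d)"
| "loop_free (While b c) = False"

primrec run :: "com \<Rightarrow> state \<Rightarrow> state" where
  "run SKIP s = s"
| "run (NWrite x e f) s = s\<lparr>nats := (nats s)(x := (nats s x)(nval e s := nval f s))\<rparr>"
| "run (RWrite x e f) s = s\<lparr>reals := (reals s)(x := (reals s x)(nval e s := rval f s))\<rparr>"
| "run (Roots x y a0 a1 a2 a3 a4) s =
    (let xs = real_roots (rval a0 s) (rval a1 s) (rval a2 s) (rval a3 s) (rval a4 s) in
     s\<lparr>reals := (reals s)(x := write_list xs (reals s x)),
       nats := (nats s)(y := (nats s y)(0 := length xs))\<rparr>)"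
| "run (Seq c d) s = run d (run c s)"
| "run (If b c d) s = (if bval b s then run c s else run d s)"
| "run (While b c) s = s"

primrec max_cost :: "com \<Rightarrow> nat" where
  "max_cost SKIP = 1"
| "max_cost (NWrite x e f) = 1 + ncost e + ncost f"
| "max_cost (RWrite x e f) = 1 + ncost e + rcost f"
| "max_cost (Roots x y a0 a1 a2 a3 a4) = 1 + rcost a0 + rcost a1 + rcost a2 + rcost a3 + rcost a4"
| "max_cost (Seq c d) = max_cost c + max_cost d"
| "max_cost (If b c d) = 1 + bcost b + max (max_cost c) (max_cost d)"
| "max_cost (While b c) = 0"

lemma exec_run:
  "loop_free c \<Longrightarrow> \<exists>t\<le>max_cost c. exec c s t (run c s)"
proof (induction c arbitrary: s)
  case (Seq c d)
  then obtain t u where "t \<le> max_cost c" "exec c s t (run c s)" "u \<le> max_cost d" "exec d (run c s) u (run d (run c s))"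
    by (metis loop_free.simps(5))
  then show ?case by (auto intro!: exI[of _ "t + u"] exec.Seq)
next
  case (If b c d)
  show ?case
  proof (cases "bval b s")
    case True
    obtain t where "t \<le> max_cost c" "exec c s t (run c s)" using If by auto
    then show ?thesis using True by (auto intro!: exI[of _ "1 + bcost b + t"] exec.IfTrue[simplified] )
  next
    case False
    obtain t where "t \<le> max_cost d" "exec d s t (run d s)" using If by auto
    then show ?thesis using False by (auto intro!: exI[of _ "1 + bcost b + t"] exec.IfFalse[simplified])
  qed
qed (auto simp: Let_def intro!: exec.Skip[simplified] exec.NWrite[simplified] exec.RWrite[simplified] exec.Roots[simplified])

text \<open>
  Total correctness with a time bound, relative to a single initial state rather than a precondition,
  so that postconditions can mention the initial state without auxiliary variables.
\<close>

definition achieves :: "com \<Rightarrow> state \<Rightarrow> nat \<Rightarrow> (state \<Rightarrow> bool) \<Rightarrow> bool" where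
  "achieves c s T Q \<longleftrightarrow> (\<exists>t s'. exec c s t s' \<and> t \<le> T \<and> Q s')"

lemma achieves_run: "loop_free c \<Longrightarrow> Q (run c s) \<Longrightarrow> achieves c s (max_cost c) Q"
  using exec_run[of c s] by (auto simp: achieves_def)

lemma achieves_Seq:
  assumes "achieves c s T P" "\<And>s'. P s' \<Longrightarrow> achieves d s' U Q"
  shows "achieves (Seq c d) s (T + U) Q"
proof -
  obtain t s' where 1: "exec c s t s'" "t \<le> T" "P s'" using assms(1) by (auto simp: achieves_def)
  obtain u s'' where 2: "exec d s' u s''" "u \<le> U" "Q s''" using assms(2)[OF 1(3)] by (auto simp: achieves_def)
  show ?thesis unfolding achieves_def
    using exec.Seq[OF 1(1) 2(1)] 1(2) 2(2,3) by (intro exI[of _ "t + u"] exI[of _ s'']) auto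
qed

lemma achieves_If:
  assumes "bval b s \<Longrightarrow> achieves c s T Q" "\<not> bval b s \<Longrightarrow> achieves d s T Q"
  shows "achieves (If b c d) s (1 + bcost b + T) Q"
proof (cases "bval b s")
  case True
  then obtain t s' where "exec c s t s'" "t \<le> T" "Q s'" using assms(1) by (auto simp: achieves_def)
  then show ?thesis unfolding achieves_def
    using exec.IfTrue[OF True] by (intro exI[of _ "1 + bcost b + t"] exI[of _ s']) auto
next
  case False
  then obtain t s' where "exec d s t s'" "t \<le> T" "Q s'" using assms(2) by (auto simp: achieves_def)
  then show ?thesis unfolding achieves_def
    using exec.IfFalse[OF False] by (intro exI[of _ "1 + bcost b + t"] exI[of _ s']) auto
qed

lemma achieves_mono:
  "achieves c s T P \<Longrightarrow> T \<le> T' \<Longrightarrow> (\<And>s'. P s' \<Longrightarrow> Q s') \<Longrightarrow> achieves c s T' Q"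
  unfolding achieves_def by (meson order_trans)

text \<open>
  The invariant carries the number \<open>n\<close> of iterations that are still allowed. It bounds that number
  from above only, so a loop may also stop early.
\<close>

lemma achieves_While:
  assumes "I n s"
    and "\<And>n s. I n s \<Longrightarrow> bval b s \<Longrightarrow> 0 < n \<and> achieves c s T (I (n - 1))"
  shows "achieves (While b c) s (1 + bcost b + n * (1 + bcost b + T)) (\<lambda>s'. (\<exists>n. I n s') \<and> \<not> bval b s')"
  using assms(1)
proof (induction n arbitrary: s)
  case 0
  then have "\<not> bval b s" using assms(2) by blast
  then show ?case unfolding achieves_def
    using exec.WhileFalse[of b s c] 0 by (intro exI[of _ "1 + bcost b"] exI[of _ s]) auto
next
  case (Suc n)
  show ?case
  proof (cases "bval b s")
    case True
    obtain t s' where 1: "exec c s t s'" "t \<le> T" "I n s'"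
      using assms(2)[OF Suc.prems True] by (auto simp: achieves_def)
    obtain u s'' where 2: "exec (While b c) s' u s''" "u \<le> 1 + bcost b + n * (1 + bcost b + T)"
      "(\<exists>n. I n s'') \<and> \<not> bval b s''"
      using Suc.IH[OF 1(3)] by (auto simp: achieves_def)
    show ?thesis unfolding achieves_def
      using exec.WhileTrue[OF True 1(1) 2(1)] 1(2) 2(2,3)
      by (intro exI[of _ "1 + bcost b + t + u"] exI[of _ s'']) auto
  next
    case False
    then show ?thesis unfolding achieves_def
      using exec.WhileFalse[of b s c] Suc.prems
      by (intro exI[of _ "1 + bcost b"] exI[of _ s]) auto
  qed
qed

primrec nat_writes :: "com \<Rightarrow> string set" where
  "nat_writes SKIP = {}"
| "nat_writes (NWrite x e f) = {x}"
| "nat_writes (RWrite x e f) = {}"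
| "nat_writes (Roots x y a0 a1 a2 a3 a4) = {y}"
| "nat_writes (Seq c d) = nat_writes c \<union> nat_writes d"
| "nat_writes (If b c d) = nat_writes c \<union> nat_writes d"
| "nat_writes (While b c) = nat_writes c"

primrec real_writes :: "com \<Rightarrow> string set" where
  "real_writes SKIP = {}"
| "real_writes (NWrite x e f) = {}"
| "real_writes (RWrite x e f) = {x}"
| "real_writes (Roots x y a0 a1 a2 a3 a4) = {x}"
| "real_writes (Seq c d) = real_writes c \<union> real_writes d"
| "real_writes (If b c d) = real_writes c \<union> real_writes d"
| "real_writes (While b c) = real_writes c"

lemma exec_frame:
  assumes "exec c s t s'"
  shows "x \<notin> nat_writes c \<Longrightarrow> nats s' x = nats s x" "y \<notin> real_writes c \<Longrightarrow> reals s' y = reals s y"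
  using assms by (induction rule: exec.induct) auto

lemma achieves_frame:
  assumes "achieves c s T Q"
  shows "achieves c s T (\<lambda>s'. Q s' \<and> (\<forall>x. x \<notin> nat_writes c \<longrightarrow> nats s' x = nats s x) \<and>
    (\<forall>x. x \<notin> real_writes c \<longrightarrow> reals s' x = reals s x))"
  using assms exec_frame unfolding achieves_def by blast

abbreviation nvar :: "string \<Rightarrow> nexp" where "nvar x \<equiv> NRead x (NConst 0)"
abbreviation rvar :: "string \<Rightarrow> rexp" where "rvar x \<equiv> RRead x (NConst 0)"
abbreviation nset :: "string \<Rightarrow> nexp \<Rightarrow> com" where "nset x e \<equiv> NWrite x (NConst 0) e"
abbreviation rset :: "string \<Rightarrow> rexp \<Rightarrow> com" where "rset x e \<equiv> RWrite x (NConst 0) e"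

section \<open>Merging sorted runs\<close>

text \<open>
  Equality of the multisets \<open>{f x | x < k}\<close> and \<open>{g x | x < k}\<close>, expressed by the sums over them. This is
  the form in which it is used (with the squares and the terms of \<^const>\<open>phi\<close> for \<open>h\<close>), and linear
  arithmetic can maintain it.
\<close>

definition sums_agree :: "nat \<Rightarrow> (nat \<Rightarrow> real) \<Rightarrow> (nat \<Rightarrow> real) \<Rightarrow> bool" where
  "sums_agree k f g \<longleftrightarrow> (\<forall>h::real \<Rightarrow> real. (\<Sum>x<k. h (f x)) = (\<Sum>x<k. h (g x)))"

definition descending :: "(nat \<Rightarrow> real) \<Rightarrow> nat \<Rightarrow> nat \<Rightarrow> bool" where
  "descending f lo hi \<longleftrightarrow> (\<forall>x y. lo \<le> x \<longrightarrow> x \<le> y \<longrightarrow> y < hi \<longrightarrow> f y \<le> f x)"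

definition runs_sorted :: "nat \<Rightarrow> nat \<Rightarrow> (nat \<Rightarrow> real) \<Rightarrow> bool" where
  "runs_sorted k w f \<longleftrightarrow> (\<forall>c. descending f (c * w) (min k (c * w + w)))"

text \<open>
  The state of a pass that merges neighbouring sorted runs of width \<open>w\<close> of \<open>f\<close> into \<open>g\<close>. The block that
  starts at \<open>c * (2 * w)\<close> and ends at \<open>v\<close> is being merged; \<open>{i..<u}\<close> and \<open>{j..<v}\<close> are the parts of its two
  runs that are still to be emitted, and \<open>p\<close> is the next position to be written. The pass is a single
  loop over \<open>p\<close> for all blocks, which makes its linear cost evident.
\<close>

definition merging ::
  "nat \<Rightarrow> nat \<Rightarrow> (nat \<Rightarrow> real) \<Rightarrow> nat \<Rightarrow> nat \<Rightarrow> nat \<Rightarrow> nat \<Rightarrow> nat \<Rightarrow> (nat \<Rightarrow> real) \<Rightarrow> bool" where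
  "merging k w f p i u j v g \<longleftrightarrow>
    runs_sorted k w f \<and>
    p \<le> v \<and> v \<le> k \<and> i \<le> u \<and> u \<le> j \<and> j \<le> v \<and> p + u = i + j \<and>
    (\<forall>h::real \<Rightarrow> real. (\<Sum>x<p. h (g x)) + (\<Sum>x=i..<u. h (f x)) + (\<Sum>x=j..<k. h (f x)) = (\<Sum>x<k. h (f x))) \<and>
    (\<exists>c. c * (2 * w) \<le> p \<and> v = min k (c * (2 * w) + 2 * w) \<and>
      descending f i u \<and> descending f j v \<and>
      (\<forall>c'<c. descending g (c' * (2 * w)) (c' * (2 * w) + 2 * w)) \<and>
      descending g (c * (2 * w)) p \<and>
      (\<forall>x y. c * (2 * w) \<le> x \<and> x < p \<and> (i \<le> y \<and> y < u \<or> j \<le> y \<and> y < v) \<longrightarrow> f y \<le> g x))"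

text \<open>
  The last block may be shorter than \<open>2 * w\<close>, and so may its first run; both cases are covered by
  cutting off at \<open>k\<close>, which leaves the second run empty if the first one is incomplete.
\<close>

lemma merging_block:
  assumes "runs_sorted k w f" "p = c * (2 * w)" "p \<le> k"
    "\<forall>c'<c. descending g (c' * (2 * w)) (c' * (2 * w) + 2 * w)"
    "\<forall>h::real \<Rightarrow> real. (\<Sum>x<p. h (g x)) + (\<Sum>x=p..<k. h (f x)) = (\<Sum>x<k. h (f x))"
  defines "u \<equiv> min k (p + w)"
  shows "merging k w f p p u u (min k (u + w)) g"
proof -
  let ?v = "min k (u + w)"
  have v: "?v = min k (p + 2 * w)" by (auto simp: u_def)
  have "descending f ((2 * c) * w) (min k ((2 * c) * w + w))"
    "descending f ((2 * c + 1) * w) (min k ((2 * c + 1) * w + w))"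
    using assms(1) unfolding runs_sorted_def by blast+
  then have "descending f p u" "descending f (p + w) ?v"
    unfolding v using assms(2) by (simp_all add: u_def algebra_simps)
  then have d: "descending f p u" "descending f u ?v"
    by (auto simp: descending_def u_def min_def)
  have pu: "p \<le> u" "u \<le> k" "p \<le> ?v" using assms(3) by (auto simp: u_def)
  have s: "(\<Sum>x=p..<u. h (f x)) + (\<Sum>x=u..<k. h (f x)) = (\<Sum>x=p..<k. h (f x))" for h :: "real \<Rightarrow> real"
    using pu by (intro sum.atLeastLessThan_concat) auto
  have "\<exists>c. c * (2 * w) \<le> p \<and> ?v = min k (c * (2 * w) + 2 * w) \<and>
      descending f p u \<and> descending f u ?v \<and>
      (\<forall>c'<c. descending g (c' * (2 * w)) (c' * (2 * w) + 2 * w)) \<and>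
      descending g (c * (2 * w)) p \<and>
      (\<forall>x y. c * (2 * w) \<le> x \<and> x < p \<and> (p \<le> y \<and> y < u \<or> u \<le> y \<and> y < ?v) \<longrightarrow> f y \<le> g x)"
    by (rule exI[of _ c]) (use assms(2,4) d v in \<open>auto simp: descending_def\<close>)
  then show ?thesis
    unfolding merging_def using assms(1,3,5) pu s by (simp add: add.assoc)
qed

lemma merging_start:
  assumes "runs_sorted k w f"
  shows "merging k w f 0 0 (min k w) (min k w) (min k (min k w + w)) g"
  using merging_block[of k w f 0 0 g] assms by (simp add: lessThan_atLeast0)

lemma merging_next_block:
  assumes "merging k w f p i u j v g" "\<not> p < v" "p < k"
  shows "merging k w f p p (min k (p + w)) (min k (p + w)) (min k (min k (p + w) + w)) g"
proof -
  from assms(1) obtain c where c: "c * (2 * w) \<le> p" "v = min k (c * (2 * w) + 2 * w)"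
      "\<forall>c'<c. descending g (c' * (2 * w)) (c' * (2 * w) + 2 * w)"
      "descending g (c * (2 * w)) p"
    unfolding merging_def by blast
  have st: "runs_sorted k w f" "p \<le> v" "i \<le> u" "u \<le> j" "j \<le> v" "p + u = i + j"
    "\<And>h::real \<Rightarrow> real. (\<Sum>x<p. h (g x)) + (\<Sum>x=i..<u. h (f x)) + (\<Sum>x=j..<k. h (f x)) = (\<Sum>x<k. h (f x))"
    using assms(1) unfolding merging_def by blast+
  have pv: "p = v" "i = u" "j = p" using st assms(2) by auto
  have p: "p = Suc c * (2 * w)" using c(2) pv assms(3) by (auto simp: min_def split: if_splits)
  show ?thesis
  proof (rule merging_block[OF st(1) p])
    show "\<forall>c'<Suc c. descending g (c' * (2 * w)) (c' * (2 * w) + 2 * w)"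
      using c(3,4) p by (auto simp: less_Suc_eq add.commute)
    show "\<forall>h::real \<Rightarrow> real. (\<Sum>x<p. h (g x)) + (\<Sum>x=p..<k. h (f x)) = (\<Sum>x<k. h (f x))"
      using st(7) pv by auto
  qed (use assms(3) in simp)
qed

text \<open>
  Emitting a maximum \<open>f z\<close> of what is left keeps the written part of the block descending and above
  the rest.
\<close>

lemma merging_emit:
  assumes m: "merging k w f p i u j v g"
    and z: "i < u \<and> z = i \<and> i' = i + 1 \<and> j' = j \<or> j < v \<and> z = j \<and> i' = i \<and> j' = j + 1"
    and max: "\<And>y. i \<le> y \<and> y < u \<or> j \<le> y \<and> y < v \<Longrightarrow> f y \<le> f z"
  shows "merging k w f (p + 1) i' u j' v (g(p := f z))"
proof -
  from m obtain c where c: "c * (2 * w) \<le> p" "v = min k (c * (2 * w) + 2 * w)"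
      "descending f i u" "descending f j v"
      "\<forall>c'<c. descending g (c' * (2 * w)) (c' * (2 * w) + 2 * w)"
      "descending g (c * (2 * w)) p"
      "\<forall>x y. c * (2 * w) \<le> x \<and> x < p \<and> (i \<le> y \<and> y < u \<or> j \<le> y \<and> y < v) \<longrightarrow> f y \<le> g x"
    unfolding merging_def by blast
  have st: "runs_sorted k w f" "p \<le> v" "v \<le> k" "i \<le> u" "u \<le> j" "j \<le> v" "p + u = i + j"
    "\<And>h::real \<Rightarrow> real. (\<Sum>x<p. h (g x)) + (\<Sum>x=i..<u. h (f x)) + (\<Sum>x=j..<k. h (f x)) = (\<Sum>x<k. h (f x))"
    using m unfolding merging_def by blast+
  let ?g = "g(p := f z)"
  have idx: "p + 1 \<le> v" "i' \<le> u" "u \<le> j'" "j' \<le> v" "p + 1 + u = i' + j'" "i \<le> i'" "j \<le> j'"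
    and zin: "i \<le> z \<and> z < u \<or> j \<le> z \<and> z < v"
    using z st by auto
  have sums: "(\<Sum>x<p+1. h (?g x)) + (\<Sum>x=i'..<u. h (f x)) + (\<Sum>x=j'..<k. h (f x)) = (\<Sum>x<k. h (f x))"
    for h :: "real \<Rightarrow> real"
  proof -
    have "(\<Sum>x<p+1. h (?g x)) = (\<Sum>x<p. h (g x)) + h (f z)" by simp
    moreover have "h (f z) + (\<Sum>x=i'..<u. h (f x)) + (\<Sum>x=j'..<k. h (f x))
        = (\<Sum>x=i..<u. h (f x)) + (\<Sum>x=j..<k. h (f x))"
      using z st by (auto simp: sum.atLeast_Suc_lessThan)
    ultimately show ?thesis using st(8)[of h] by linarith
  qed
  have old: "descending ?g lo hi" if "descending g lo hi" "hi \<le> p" for lo hi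
    using that st by (auto simp: descending_def)
  have "c' * (2 * w) + 2 * w \<le> p" if "c' < c" for c'
  proof -
    have "Suc c' * (2 * w) \<le> c * (2 * w)" using that by (intro mult_right_mono) auto
    then show ?thesis using c(1) by simp
  qed
  then have e: "\<forall>c'<c. descending ?g (c' * (2 * w)) (c' * (2 * w) + 2 * w)"
    using c(5) old by blast
  have d: "descending ?g (c * (2 * w)) (p + 1)"
    using c(6,7) zin by (auto simp: descending_def less_Suc_eq)
  have r: "\<forall>x y. c * (2 * w) \<le> x \<and> x < p + 1 \<and> (i' \<le> y \<and> y < u \<or> j' \<le> y \<and> y < v) \<longrightarrow> f y \<le> ?g x"
    using c(7) max idx by (auto simp: less_Suc_eq)
  have "descending f i' u" "descending f j' v"
    using c(3,4) idx by (auto simp: descending_def)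
  then show ?thesis
    unfolding merging_def using st idx sums c(1,2) e d r by (intro conjI exI[of _ c]) auto
qed

lemma merging_finish:
  assumes "merging k w f k i u j v g"
  shows "runs_sorted k (2 * w) g" "sums_agree k f g"
proof -
  from assms obtain c where c: "c * (2 * w) \<le> k" "v = min k (c * (2 * w) + 2 * w)"
      "\<forall>c'<c. descending g (c' * (2 * w)) (c' * (2 * w) + 2 * w)"
      "descending g (c * (2 * w)) k"
    unfolding merging_def by blast
  have st: "k \<le> v" "v \<le> k" "i \<le> u" "u \<le> j" "j \<le> v" "k + u = i + j"
    "\<And>h::real \<Rightarrow> real. (\<Sum>x<k. h (g x)) + (\<Sum>x=i..<u. h (f x)) + (\<Sum>x=j..<k. h (f x)) = (\<Sum>x<k. h (f x))"
    using assms unfolding merging_def by blast+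
  have e: "i = u" "j = k" "k \<le> c * (2 * w) + 2 * w" using st c(2) by auto
  show "sums_agree k f g" using st(7) e by (simp add: sums_agree_def)
  have "descending g (c' * (2 * w)) (min k (c' * (2 * w) + 2 * w))" for c'
  proof (cases c' c rule: linorder_cases)
    case less
    then show ?thesis using c(3) by (auto simp: descending_def)
  next
    case equal
    then show ?thesis using c(4) by (auto simp: descending_def)
  next
    case greater
    then have "Suc c * (2 * w) \<le> c' * (2 * w)" by (intro mult_right_mono) auto
    then show ?thesis using e(3) by (auto simp: descending_def)
  qed
  then show "runs_sorted k (2 * w) g" by (simp add: runs_sorted_def)
qed

lemma merging_step:
  assumes m: "merging k w f p i u j v g" and "p < v"
  shows "i < u \<and> \<not> (j < v \<and> f i < f j) \<Longrightarrow> merging k w f (p + 1) (i + 1) u j v (g(p := f i))"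
    and "\<not> (i < u \<and> \<not> (j < v \<and> f i < f j)) \<Longrightarrow> merging k w f (p + 1) i u (j + 1) v (g(p := f j))"
proof -
  have st: "descending f i u" "descending f j v" "p + u = i + j" "i \<le> u"
    using m unfolding merging_def by blast+
  have d: "f y \<le> f i" if "i \<le> y" "y < u" for y
    using that st by (auto simp: descending_def)
  have d': "f y \<le> f j" if "j \<le> y" "y < v" for y
    using that st by (auto simp: descending_def)
  show "merging k w f (p + 1) (i + 1) u j v (g(p := f i))" if a: "i < u \<and> \<not> (j < v \<and> f i < f j)"
  proof (rule merging_emit[OF m])
    fix y assume y: "i \<le> y \<and> y < u \<or> j \<le> y \<and> y < v"
    show "f y \<le> f i"
    proof (cases "i \<le> y \<and> y < u")
      case False
      then have "j \<le> y" "y < v" using y by auto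
      then have "f y \<le> f j" "j < v" using d' by auto
      then show ?thesis using a by linarith
    qed (use d in auto)
  qed (use a in auto)
  show "merging k w f (p + 1) i u (j + 1) v (g(p := f j))" if a: "\<not> (i < u \<and> \<not> (j < v \<and> f i < f j))"
  proof (rule merging_emit[OF m])
    have "j < v" using a st assms(2) by linarith
    then show "i < u \<and> j = i \<and> i = i + 1 \<and> j + 1 = j \<or> j < v \<and> j = j \<and> i = i \<and> j + 1 = j + 1" by simp
    fix y assume y: "i \<le> y \<and> y < u \<or> j \<le> y \<and> y < v"
    show "f y \<le> f j"
    proof (cases "j \<le> y \<and> y < v")
      case False
      then have "i \<le> y" "y < u" using y by auto
      then have "f y \<le> f i" "i < u" using d by auto
      then show ?thesis using a by linarith
    qed (use d' in auto)
  qed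
qed


section \<open>Merge sort as a program\<close>

text \<open>
  The arrays \<open>a\<close> and \<open>b\<close> hold the values to be sorted and the output of a merging pass. The scalars \<open>p\<close>,
  \<open>i\<close>, \<open>u\<close>, \<open>j\<close>, \<open>v\<close>, \<open>w\<close> are the indices of \<^const>\<open>merging\<close>.
\<close>

definition new_block :: com where
  "new_block =
    Seq (nset ''i'' (nvar ''p''))
   (Seq (If (NLess (nvar ''card'') (NAdd (nvar ''p'') (nvar ''w'')))
          (nset ''u'' (nvar ''card'')) (nset ''u'' (NAdd (nvar ''p'') (nvar ''w''))))
   (Seq (nset ''j'' (nvar ''u''))
        (If (NLess (nvar ''card'') (NAdd (nvar ''u'') (nvar ''w'')))
          (nset ''v'' (nvar ''card'')) (nset ''v'' (NAdd (nvar ''u'') (nvar ''w''))))))"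

definition emit_larger :: com where
  "emit_larger =
    Seq (If (BAnd (NLess (nvar ''i'') (nvar ''u''))
                  (BNot (BAnd (NLess (nvar ''j'') (nvar ''v''))
                              (RLess (RRead ''a'' (nvar ''i'')) (RRead ''a'' (nvar ''j''))))))
          (Seq (RWrite ''b'' (nvar ''p'') (RRead ''a'' (nvar ''i'')))
               (nset ''i'' (NAdd (nvar ''i'') (NConst 1))))
          (Seq (RWrite ''b'' (nvar ''p'') (RRead ''a'' (nvar ''j'')))
               (nset ''j'' (NAdd (nvar ''j'') (NConst 1)))))
        (nset ''p'' (NAdd (nvar ''p'') (NConst 1)))"

definition merge_step :: com where
  "merge_step = Seq (If (NLess (nvar ''p'') (nvar ''v'')) SKIP new_block) emit_larger"

definition merge_pass :: com where
  "merge_pass = Seq (Seq (nset ''p'' (NConst 0)) new_block)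
     (While (NLess (nvar ''p'') (nvar ''card'')) merge_step)"

definition copy_step :: com where
  "copy_step = Seq (RWrite ''a'' (nvar ''p'') (RRead ''b'' (nvar ''p'')))
     (nset ''p'' (NAdd (nvar ''p'') (NConst 1)))"

definition copy_back :: com where
  "copy_back = Seq (nset ''p'' (NConst 0)) (While (NLess (nvar ''p'') (nvar ''card'')) copy_step)"

definition merge_sort :: com where
  "merge_sort = Seq (nset ''w'' (NConst 1))
     (While (NLess (nvar ''w'') (nvar ''card''))
       (Seq merge_pass (Seq copy_back (nset ''w'' (NAdd (nvar ''w'') (nvar ''w''))))))"

text \<open>
  Moving the case distinction into the written value keeps the state a single term; otherwise each
  conditional doubles the terms that arise from the commands after it.
\<close>

lemma run_If_NWrite:
  "run (If b (NWrite x e f) (NWrite x e g)) s =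
    s\<lparr>nats := (nats s)(x := (nats s x)(nval e s := if bval b s then nval f s else nval g s))\<rparr>"
  by simp

lemma run_new_block:
  "run new_block s = s\<lparr>nats := (nats s)(
     ''i'' := (nats s ''i'')(0 := nats s ''p'' 0),
     ''u'' := (nats s ''u'')(0 := min (nats s ''card'' 0) (nats s ''p'' 0 + nats s ''w'' 0)),
     ''j'' := (nats s ''j'')(0 := min (nats s ''card'' 0) (nats s ''p'' 0 + nats s ''w'' 0)),
     ''v'' := (nats s ''v'')(0 := min (nats s ''card'' 0)
        (min (nats s ''card'' 0) (nats s ''p'' 0 + nats s ''w'' 0) + nats s ''w'' 0)))\<rparr>"
  unfolding new_block_def run.simps(5) run_If_NWrite
  by (simp add: min_def)

lemma loop_free_new_block [simp]: "loop_free new_block"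
  by (simp add: new_block_def)

definition while_cost :: "bexp \<Rightarrow> nat \<Rightarrow> nat \<Rightarrow> nat" where
  "while_cost b n T = 1 + bcost b + n * (1 + bcost b + T)"

definition merge_inv :: "nat \<Rightarrow> nat \<Rightarrow> (nat \<Rightarrow> real) \<Rightarrow> nat \<Rightarrow> state \<Rightarrow> bool" where
  "merge_inv k w f n s \<longleftrightarrow> nats s ''card'' 0 = k \<and> nats s ''w'' 0 = w \<and> reals s ''a'' = f \<and>
    n = k - nats s ''p'' 0 \<and>
    merging k w f (nats s ''p'' 0) (nats s ''i'' 0) (nats s ''u'' 0) (nats s ''j'' 0) (nats s ''v'' 0) (reals s ''b'')"

lemma merge_step_correct:
  assumes inv: "merge_inv k w f n s" and "0 < w" and p: "nats s ''p'' 0 < k"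
  shows "0 < n \<and> achieves merge_step s (max_cost merge_step) (merge_inv k w f (n - 1))"
proof -
  let ?c = "If (NLess (nvar ''p'') (nvar ''v'')) SKIP new_block"
  have step1: "merge_inv k w f n (run ?c s) \<and> nats (run ?c s) ''p'' 0 < nats (run ?c s) ''v'' 0"
  proof (cases "nats s ''p'' 0 < nats s ''v'' 0")
    case True
    then show ?thesis using inv by simp
  next
    case False
    let ?p = "nats s ''p'' 0"
    have "merging k w f ?p ?p (min k (?p + w)) (min k (?p + w)) (min k (min k (?p + w) + w)) (reals s ''b'')"
      using inv False p merging_next_block unfolding merge_inv_def by blast
    then show ?thesis
      using inv False p \<open>0 < w\<close> by (simp add: merge_inv_def run_new_block)
  qed
  have step2: "merge_inv k w f (n - 1) (run emit_larger t)"
    if t: "merge_inv k w f n t" "nats t ''p'' 0 < nats t ''v'' 0" for t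
  proof -
    let ?i = "nats t ''i'' 0" and ?u = "nats t ''u'' 0" and ?j = "nats t ''j'' 0" and ?v = "nats t ''v'' 0"
    have m: "merging k w f (nats t ''p'' 0) ?i ?u ?j ?v (reals t ''b'')" and f: "reals t ''a'' = f"
      using t by (simp_all add: merge_inv_def)
    show ?thesis
    proof (cases "?i < ?u \<and> \<not> (?j < ?v \<and> f ?i < f ?j)")
      case True
      then show ?thesis
        using t merging_step(1)[OF m t(2) True] by (simp add: merge_inv_def emit_larger_def f)
    next
      case False
      then show ?thesis
        using t merging_step(2)[OF m t(2) False] by (auto simp add: merge_inv_def emit_larger_def f)
    qed
  qed
  have "merge_inv k w f (n - 1) (run merge_step s)"
    using step2[of "run ?c s"] step1 by (simp add: merge_step_def)
  then have "achieves merge_step s (max_cost merge_step) (merge_inv k w f (n - 1))"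
    by (intro achieves_run) (simp_all add: merge_step_def emit_larger_def)
  then show ?thesis using inv p by (auto simp: merge_inv_def)
qed

abbreviation "p_lt_card \<equiv> NLess (nvar ''p'') (nvar ''card'')"

definition merge_pass_cost :: "nat \<Rightarrow> nat" where
  "merge_pass_cost k = max_cost (Seq (nset ''p'' (NConst 0)) new_block)
     + while_cost p_lt_card k (max_cost merge_step)"

lemma merge_pass_correct:
  assumes "nats s ''card'' 0 = k" "nats s ''w'' 0 = w" "0 < w" "runs_sorted k w (reals s ''a'')"
  shows "achieves merge_pass s (merge_pass_cost k)
    (\<lambda>s'. runs_sorted k (2 * w) (reals s' ''b'') \<and> sums_agree k (reals s ''a'') (reals s' ''b''))"
  unfolding merge_pass_def merge_pass_cost_def
proof (rule achieves_Seq)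
  let ?f = "reals s ''a''"
  show "achieves (Seq (nset ''p'' (NConst 0)) new_block) s
      (max_cost (Seq (nset ''p'' (NConst 0)) new_block)) (merge_inv k w ?f k)"
    using assms merging_start[OF assms(4), of "reals s ''b''"]
    by (intro achieves_run) (simp_all add: merge_inv_def run_new_block)
  fix t assume t: "merge_inv k w ?f k t"
  have "achieves (While p_lt_card merge_step) t (while_cost p_lt_card k (max_cost merge_step))
      (\<lambda>s'. (\<exists>n. merge_inv k w ?f n s') \<and> \<not> bval p_lt_card s')"
    unfolding while_cost_def
    by (rule achieves_While[where I = "merge_inv k w ?f", OF t], rule merge_step_correct)
      (use assms(3) in \<open>auto simp: merge_inv_def\<close>)
  then show "achieves (While p_lt_card merge_step) t (while_cost p_lt_card k (max_cost merge_step))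
      (\<lambda>s'. runs_sorted k (2 * w) (reals s' ''b'') \<and> sums_agree k ?f (reals s' ''b''))"
  proof (rule achieves_mono[OF _ order_refl])
    fix s' assume "(\<exists>n. merge_inv k w ?f n s') \<and> \<not> bval p_lt_card s'"
    then have "merging k w ?f (nats s' ''p'' 0) (nats s' ''i'' 0) (nats s' ''u'' 0) (nats s' ''j'' 0) (nats s' ''v'' 0) (reals s' ''b'')"
      and "k \<le> nats s' ''p'' 0" by (auto simp: merge_inv_def)
    moreover from this have "nats s' ''p'' 0 = k" unfolding merging_def by linarith
    ultimately show "runs_sorted k (2 * w) (reals s' ''b'') \<and> sums_agree k ?f (reals s' ''b'')"
      using merging_finish by metis
  qed
qed

definition copy_back_cost :: "nat \<Rightarrow> nat" where
  "copy_back_cost k = max_cost (nset ''p'' (NConst 0)) + while_cost p_lt_card k (max_cost copy_step)"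

lemma copy_back_correct:
  assumes "nats s ''card'' 0 = k"
  shows "achieves copy_back s (copy_back_cost k) (\<lambda>s'. \<forall>x<k. reals s' ''a'' x = reals s ''b'' x)"
  unfolding copy_back_def copy_back_cost_def
proof (rule achieves_Seq)
  define I where "I n t \<longleftrightarrow> nats t ''card'' 0 = k \<and> reals t ''b'' = reals s ''b'' \<and> n = k - nats t ''p'' 0 \<and>
    (\<forall>x<nats t ''p'' 0. reals t ''a'' x = reals s ''b'' x)" for n and t :: state
  show "achieves (nset ''p'' (NConst 0)) s (max_cost (nset ''p'' (NConst 0))) (I k)"
    using assms by (intro achieves_run) (auto simp: I_def)
  fix t assume t: "I k t"
  have "achieves (While p_lt_card copy_step) t (while_cost p_lt_card k (max_cost copy_step))
      (\<lambda>s'. (\<exists>n. I n s') \<and> \<not> bval p_lt_card s')"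
    unfolding while_cost_def
  proof (rule achieves_While[where I = I, OF t])
    fix n and t :: state assume a: "I n t" "bval p_lt_card t"
    then have "I (n - 1) (run copy_step t)" by (auto simp: I_def copy_step_def less_Suc_eq)
    then have "achieves copy_step t (max_cost copy_step) (I (n - 1))"
      by (intro achieves_run) (simp_all add: copy_step_def)
    then show "0 < n \<and> achieves copy_step t (max_cost copy_step) (I (n - 1))"
      using a by (auto simp: I_def)
  qed
  then show "achieves (While p_lt_card copy_step) t (while_cost p_lt_card k (max_cost copy_step))
      (\<lambda>s'. \<forall>x<k. reals s' ''a'' x = reals s ''b'' x)"
    by (rule achieves_mono[OF _ order_refl]) (auto simp: I_def)
qed

abbreviation "w_lt_card \<equiv> NLess (nvar ''w'') (nvar ''card'')"

definition merge_sort_cost :: "nat \<Rightarrow> nat \<Rightarrow> nat" where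
  "merge_sort_cost k n = max_cost (nset ''w'' (NConst 1)) + while_cost w_lt_card n
     (merge_pass_cost k + (copy_back_cost k + max_cost (nset ''w'' (NAdd (nvar ''w'') (nvar ''w'')))))"

lemma runs_sorted_1: "runs_sorted k (Suc 0) f"
proof -
  have "x = y" if "c \<le> x" "x \<le> y" "y < min k (c + 1)" for c x y :: nat
    using that by linarith
  then show ?thesis unfolding runs_sorted_def descending_def by fastforce
qed

lemma merge_pass_frame: "''card'' \<notin> nat_writes merge_pass" "''w'' \<notin> nat_writes merge_pass"
  by (simp_all add: merge_pass_def merge_step_def new_block_def emit_larger_def)

lemma copy_back_frame: "''card'' \<notin> nat_writes copy_back" "''w'' \<notin> nat_writes copy_back"
  by (simp_all add: copy_back_def copy_step_def)

text \<open>
  After every pass the width doubles, so \<open>k \<le> w * 2 ^ n\<close> bounds the number \<open>n\<close> of remaining passes.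
\<close>

lemma merge_sort_correct:
  assumes "nats s ''card'' 0 = k" "k \<le> 2 ^ n"
  shows "achieves merge_sort s (merge_sort_cost k n)
    (\<lambda>s'. descending (reals s' ''a'') 0 k \<and> sums_agree k (reals s ''a'') (reals s' ''a''))"
  unfolding merge_sort_def merge_sort_cost_def
proof (rule achieves_Seq)
  define I where "I n t \<longleftrightarrow> nats t ''card'' 0 = k \<and> sums_agree k (reals s ''a'') (reals t ''a'') \<and>
    runs_sorted k (nats t ''w'' 0) (reals t ''a'') \<and> 0 < nats t ''w'' 0 \<and> k \<le> nats t ''w'' 0 * 2 ^ n" for n and t :: state
  show "achieves (nset ''w'' (NConst 1)) s (max_cost (nset ''w'' (NConst 1))) (I n)"
    using assms by (intro achieves_run) (simp_all add: I_def sums_agree_def runs_sorted_1)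
  let ?dbl = "nset ''w'' (NAdd (nvar ''w'') (nvar ''w''))"
  let ?T = "merge_pass_cost k + (copy_back_cost k + max_cost ?dbl)"
  let ?body = "Seq merge_pass (Seq copy_back ?dbl)"
  fix t assume t: "I n t"
  have "achieves (While w_lt_card ?body) t (while_cost w_lt_card n ?T)
      (\<lambda>s'. (\<exists>n. I n s') \<and> \<not> bval w_lt_card s')"
    unfolding while_cost_def
  proof (rule achieves_While[where I = I, OF t])
    fix n and t :: state assume a: "I n t" "bval w_lt_card t"
    let ?w = "nats t ''w'' 0" and ?f = "reals t ''a''"
    have "n \<noteq> 0" using a by (intro notI) (auto simp: I_def)
    moreover have "achieves ?body t ?T (I (n - 1))"
    proof (rule achieves_Seq)
      show "achieves merge_pass t (merge_pass_cost k)
        (\<lambda>s'. (runs_sorted k (2 * ?w) (reals s' ''b'') \<and> sums_agree k ?f (reals s' ''b'')) \<and>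
          (\<forall>x. x \<notin> nat_writes merge_pass \<longrightarrow> nats s' x = nats t x) \<and>
          (\<forall>x. x \<notin> real_writes merge_pass \<longrightarrow> reals s' x = reals t x))"
        using a by (intro achieves_frame[OF merge_pass_correct]) (simp_all add: I_def)
      fix t1 :: state assume t1: "(runs_sorted k (2 * ?w) (reals t1 ''b'') \<and> sums_agree k ?f (reals t1 ''b'')) \<and>
          (\<forall>x. x \<notin> nat_writes merge_pass \<longrightarrow> nats t1 x = nats t x) \<and>
          (\<forall>x. x \<notin> real_writes merge_pass \<longrightarrow> reals t1 x = reals t x)"
      then have c1: "nats t1 ''card'' 0 = k" "nats t1 ''w'' 0 = ?w"
        using a(1)[unfolded I_def] merge_pass_frame by metis+
      show "achieves (Seq copy_back ?dbl) t1 (copy_back_cost k + max_cost ?dbl) (I (n - 1))"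
      proof (rule achieves_Seq)
        show "achieves copy_back t1 (copy_back_cost k)
          (\<lambda>s'. (\<forall>x<k. reals s' ''a'' x = reals t1 ''b'' x) \<and>
            (\<forall>x. x \<notin> nat_writes copy_back \<longrightarrow> nats s' x = nats t1 x) \<and>
            (\<forall>x. x \<notin> real_writes copy_back \<longrightarrow> reals s' x = reals t1 x))"
          by (rule achieves_frame[OF copy_back_correct[OF c1(1)]])
        fix t2 :: state assume t2: "(\<forall>x<k. reals t2 ''a'' x = reals t1 ''b'' x) \<and>
            (\<forall>x. x \<notin> nat_writes copy_back \<longrightarrow> nats t2 x = nats t1 x) \<and>
            (\<forall>x. x \<notin> real_writes copy_back \<longrightarrow> reals t2 x = reals t1 x)"
        then have c2: "nats t2 ''card'' 0 = k" "nats t2 ''w'' 0 = ?w"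
          using c1 copy_back_frame by metis+
        have r: "runs_sorted k (2 * ?w) (reals t2 ''a'')"
        proof -
          have "runs_sorted k (2 * ?w) (reals t1 ''b'')" "\<And>x. x < k \<Longrightarrow> reals t2 ''a'' x = reals t1 ''b'' x"
            using t1 t2 by blast+
          then show ?thesis by (simp add: runs_sorted_def descending_def)
        qed
        have sa: "sums_agree k (reals s ''a'') (reals t2 ''a'')"
          using t1 t2 a(1)[unfolded I_def] by (simp add: sums_agree_def)
        obtain n' where "n = Suc n'" using \<open>n \<noteq> 0\<close> not0_implies_Suc by blast
        then have "k \<le> (?w + ?w) * 2 ^ (n - 1)"
          using a by (simp add: I_def algebra_simps)
        then show "achieves ?dbl t2 (max_cost ?dbl) (I (n - 1))"
          using c2 r sa a(1)[unfolded I_def]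
          by (intro achieves_run) (simp_all add: I_def mult_2)
      qed
    qed
    ultimately show "0 < n \<and> achieves ?body t ?T (I (n - 1))" by simp
  qed
  then show "achieves (While w_lt_card ?body) t (while_cost w_lt_card n ?T)
      (\<lambda>s'. descending (reals s' ''a'') 0 k \<and> sums_agree k (reals s ''a'') (reals s' ''a''))"
  proof (rule achieves_mono[OF _ order_refl])
    fix s' assume "(\<exists>n. I n s') \<and> \<not> bval w_lt_card s'"
    then have "runs_sorted k (nats s' ''w'' 0) (reals s' ''a'')" "k \<le> nats s' ''w'' 0"
      "sums_agree k (reals s ''a'') (reals s' ''a'')" by (auto simp: I_def)
    moreover from this have "descending (reals s' ''a'') 0 (min k (nats s' ''w'' 0))"
      unfolding runs_sorted_def by (metis add_0 mult_0)
    ultimately show "descending (reals s' ''a'') 0 k \<and> sums_agree k (reals s ''a'') (reals s' ''a'')"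
      by simp
  qed
qed

section \<open>Square roots and positive roots of quartics\<close>

text \<open>
  The roots are stored in increasing order and all of them other than \<open>z\<close> are nonpositive, so \<open>z\<close> is
  the last one. This is how a program selects the positive root without a search.
\<close>

lemma last_real_root:
  assumes "poly [:a0, a1, a2, a3, a4:] z = 0" "0 < z" "[:a0, a1, a2, a3, a4:] \<noteq> 0"
    and uniq: "\<And>x. 0 < x \<Longrightarrow> poly [:a0, a1, a2, a3, a4:] x = 0 \<Longrightarrow> x = z"
  shows "write_list (real_roots a0 a1 a2 a3 a4) f (length (real_roots a0 a1 a2 a3 a4) - 1) = z"
proof -
  define p where "p = [:a0, a1, a2, a3, a4:]"
  define xs where "xs = real_roots a0 a1 a2 a3 a4"
  have xs: "set xs = {x. poly p x = 0}" "sorted xs"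
    using poly_roots_finite[of p] assms(3) by (simp_all add: xs_def real_roots_def flip: p_def)
  have "z \<in> set xs" using assms(1) xs(1) by (simp flip: p_def)
  then obtain i where i: "i < length xs" "xs ! i = z"
    by (auto simp: in_set_conv_nth)
  have "z \<le> xs ! (length xs - 1)"
    using sorted_nth_mono[OF xs(2), of i "length xs - 1"] i by simp
  moreover have "xs ! (length xs - 1) \<in> set xs"
    using i by (intro nth_mem) simp
  then have "poly p (xs ! (length xs - 1)) = 0" using xs(1) by blast
  ultimately have "xs ! (length xs - 1) = z"
    using uniq[folded p_def] assms(2) by simp
  moreover have "length xs - 1 < length xs" using i by simp
  ultimately show ?thesis by (simp add: write_list_def flip: xs_def)
qed

text \<open>
  The square root in \<^const>\<open>xi\<close> is obtained as the positive root of \<open>x\<^sup>2 - max m n\<close>.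
\<close>

definition compute_xi :: com where
  "compute_xi =
    Seq (If (NLess (nvar ''m'') (nvar ''n'')) (nset ''w'' (nvar ''n'')) (nset ''w'' (nvar ''m'')))
   (Seq (Roots ''x'' ''y'' (RSub (RNat (NConst 0)) (RNat (nvar ''w''))) (RNat (NConst 0)) (RNat (NConst 1))
          (RNat (NConst 0)) (RNat (NConst 0)))
        (rset ''xi'' (RDiv (RNat (NConst 1)) (RRead ''x'' (NSub (nvar ''y'') (NConst 1))))))"

lemma compute_xi_correct:
  assumes "nats s ''m'' 0 = m" "nats s ''n'' 0 = n" "0 < m"
  shows "achieves compute_xi s (max_cost compute_xi) (\<lambda>s'. reals s' ''xi'' 0 = xi m n)"
proof (rule achieves_run)
  define M where "M = real (max m n)"
  have M: "0 < M" using assms(3) by (simp add: M_def)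
  have "x = sqrt M" if "0 < x" "x * x = M" for x
    using that by (simp flip: that(2))
  then have "write_list (real_roots (- M) 0 1 0 0) f (length (real_roots (- M) 0 1 0 0) - 1) = sqrt M" for f
    using M by (intro last_real_root) auto
  then show "reals (run compute_xi s) ''xi'' 0 = xi m n"
    using assms by (auto simp: compute_xi_def Let_def xi_def M_def max_def)
qed (simp add: compute_xi_def)


section \<open>Computing the entries\<close>

abbreviation "i_lt_card \<equiv> NLess (nvar ''i'') (nvar ''card'')"

definition load_step :: com where
  "load_step =
    (let pos = NAdd (NMul (NRead ''row'' (nvar ''i'')) (nvar ''n'')) (NRead ''col'' (nvar ''i'')) in
    Seq (rset ''x'' (RSub (RRead ''D'' pos) (RRead ''q'' pos)))
   (Seq (If (RLess (rvar ''x'') (RNat (NConst 0)))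
          (RWrite ''a'' (nvar ''i'') (RSub (RNat (NConst 0)) (rvar ''x'')))
          (RWrite ''a'' (nvar ''i'') (rvar ''x'')))
   (Seq (rset ''r'' (RAdd (rvar ''r'') (RMul (rvar ''x'') (rvar ''x''))))
        (nset ''i'' (NAdd (nvar ''i'') (NConst 1))))))"

definition load_entries :: com where
  "load_entries = Seq (Seq (nset ''i'' (NConst 0)) (rset ''r'' (RNat (NConst 0))))
     (While i_lt_card load_step)"

definition load_cost :: "nat \<Rightarrow> nat" where
  "load_cost k = max_cost (Seq (nset ''i'' (NConst 0)) (rset ''r'' (RNat (NConst 0))))
     + while_cost i_lt_card k (max_cost load_step)"

lemma load_entries_correct:
  assumes "nats s ''card'' 0 = k"
  defines "d \<equiv> \<lambda>x. reals s ''D'' (nats s ''row'' x * nats s ''n'' 0 + nats s ''col'' x)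
    - reals s ''q'' (nats s ''row'' x * nats s ''n'' 0 + nats s ''col'' x)"
  shows "achieves load_entries s (load_cost k)
    (\<lambda>s'. (\<forall>x<k. reals s' ''a'' x = \<bar>d x\<bar>) \<and> reals s' ''r'' 0 = (\<Sum>x<k. (d x)\<^sup>2))"
  unfolding load_entries_def load_cost_def
proof (rule achieves_Seq)
  define I where "I n t \<longleftrightarrow> nats t ''card'' 0 = k \<and> nats t ''row'' = nats s ''row'' \<and>
    nats t ''col'' = nats s ''col'' \<and> nats t ''n'' = nats s ''n'' \<and>
    reals t ''D'' = reals s ''D'' \<and> reals t ''q'' = reals s ''q'' \<and>
    nats t ''i'' 0 \<le> k \<and> n = k - nats t ''i'' 0 \<and>
    (\<forall>x<nats t ''i'' 0. reals t ''a'' x = \<bar>d x\<bar>) \<and>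
    reals t ''r'' 0 = (\<Sum>x<nats t ''i'' 0. (d x)\<^sup>2)" for n and t :: state
  let ?init = "Seq (nset ''i'' (NConst 0)) (rset ''r'' (RNat (NConst 0)))"
  show "achieves ?init s (max_cost ?init) (I k)"
    using assms(1) by (intro achieves_run) (auto simp: I_def)
  fix t assume t: "I k t"
  have "achieves (While i_lt_card load_step) t (while_cost i_lt_card k (max_cost load_step))
      (\<lambda>s'. (\<exists>n. I n s') \<and> \<not> bval i_lt_card s')"
    unfolding while_cost_def
  proof (rule achieves_While[where I = I, OF t])
    fix n and t :: state assume a: "I n t" "bval i_lt_card t"
    let ?i = "nats t ''i'' 0"
    have "I (n - 1) (run load_step t)"
    proof (cases "d ?i < 0")
      case True
      then show ?thesis
        using a unfolding I_def d_def
        by (auto simp: load_step_def Let_def less_Suc_eq power2_eq_square)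
    next
      case False
      then show ?thesis
        using a unfolding I_def d_def
        by (auto simp: load_step_def Let_def less_Suc_eq power2_eq_square)
    qed
    then have "achieves load_step t (max_cost load_step) (I (n - 1))"
      by (intro achieves_run) (simp_all add: load_step_def Let_def)
    then show "0 < n \<and> achieves load_step t (max_cost load_step) (I (n - 1))"
      using a by (auto simp: I_def)
  qed
  then show "achieves (While i_lt_card load_step) t (while_cost i_lt_card k (max_cost load_step))
      (\<lambda>s'. (\<forall>x<k. reals s' ''a'' x = \<bar>d x\<bar>) \<and> reals s' ''r'' 0 = (\<Sum>x<k. (d x)\<^sup>2))"
  proof (rule achieves_mono[OF _ order_refl])
    fix s' assume s': "(\<exists>n. I n s') \<and> \<not> bval i_lt_card s'"
    then have "nats s' ''i'' 0 = k" by (auto simp: I_def)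
    then show "(\<forall>x<k. reals s' ''a'' x = \<bar>d x\<bar>) \<and> reals s' ''r'' 0 = (\<Sum>x<k. (d x)\<^sup>2)"
      using s' by (auto simp: I_def)
  qed
qed

section \<open>Locating theta among the breakpoints\<close>

text \<open>
  The hypothesis is \<open>c / \<theta> \<le> a / (1 + r \<theta>)\<close> with denominators cleared; it holds from
  \<open>\<theta> = c / (a - c r)\<close> on if \<open>a > c r\<close>, and, for positive \<open>c\<close>, never otherwise.
\<close>

lemma clipped_saturated:
  assumes "0 < \<theta>" "0 < r" "c \<le> (a - c * r) * \<theta>"
  shows "clipped_square c r \<theta> a = c\<^sup>2 / \<theta>\<^sup>2"
proof -
  have "0 < 1 + r * \<theta>" using assms by (simp add: add_pos_pos)
  then have "c / \<theta> \<le> a / (1 + r * \<theta>)" using assms by (simp add: field_simps)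
  then show ?thesis by (simp add: clipped_square_def min_absorb1 power_divide)
qed

lemma clipped_unsaturated:
  assumes "0 < \<theta>" "0 < r" "(a - c * r) * \<theta> \<le> c"
  shows "clipped_square c r \<theta> a = a\<^sup>2 / (1 + r * \<theta>)\<^sup>2"
proof -
  have "0 < 1 + r * \<theta>" using assms by (simp add: add_pos_pos)
  then have "a / (1 + r * \<theta>) \<le> c / \<theta>" using assms by (simp add: field_simps)
  then show ?thesis by (simp add: clipped_square_def min_absorb2 power_divide)
qed

lemma clipped_sum_split:
  assumes "0 < \<theta>" "0 < r" "j \<le> k"
    and "\<And>x. x < j \<Longrightarrow> c \<le> (s x - c * r) * \<theta>"
    and "\<And>x. j \<le> x \<Longrightarrow> x < k \<Longrightarrow> (s x - c * r) * \<theta> \<le> c"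
  shows "(\<Sum>x<k. clipped_square c r \<theta> (s x)) = real j * c\<^sup>2 / \<theta>\<^sup>2 + (\<Sum>x=j..<k. (s x)\<^sup>2) / (1 + r * \<theta>)\<^sup>2"
proof -
  have "(\<Sum>x<k. clipped_square c r \<theta> (s x)) = (\<Sum>x=0..<j. clipped_square c r \<theta> (s x)) + (\<Sum>x=j..<k. clipped_square c r \<theta> (s x))"
    unfolding lessThan_atLeast0 using assms(3) by (intro sum.atLeastLessThan_concat[symmetric]) auto
  moreover have "(\<Sum>x=0..<j. clipped_square c r \<theta> (s x)) = (\<Sum>x=0..<j. c\<^sup>2 / \<theta>\<^sup>2)"
    using assms by (intro sum.cong) (auto simp: clipped_saturated)
  moreover have "(\<Sum>x=j..<k. clipped_square c r \<theta> (s x)) = (\<Sum>x=j..<k. (s x)\<^sup>2 / (1 + r * \<theta>)\<^sup>2)"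
    using assms by (intro sum.cong) (auto simp: clipped_unsaturated)
  ultimately show ?thesis by (simp add: sum_divide_distrib)
qed

text \<open>
  At the breakpoint of \<open>s j\<close> the entries before position \<open>j\<close> are saturated and the others are not (with
  equality for \<open>s j\<close> itself), so the sum depends only on \<open>j\<close> and the sum of the remaining squares and
  can be evaluated in constant time.
\<close>

lemma clipped_sum_at_breakpoint:
  assumes "descending s 0 k" "j < k" "0 < c" "0 < r" "c * r < s j"
  shows "(\<Sum>x<k. clipped_square c r (c / (s j - c * r)) (s x))
    = real j * (s j - c * r)\<^sup>2 + (\<Sum>x=j..<k. (s x)\<^sup>2) * (s j - c * r)\<^sup>2 / (s j)\<^sup>2"
proof -
  define e where "e = s j - c * r"
  have e: "0 < e" using assms by (simp add: e_def)
  have sj: "s j = e + c * r" "0 < s j" using assms by (auto simp: e_def intro: less_trans[of _ "c * r"])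
  have "(\<Sum>x<k. clipped_square c r (c / e) (s x)) = real j * c\<^sup>2 / (c / e)\<^sup>2 + (\<Sum>x=j..<k. (s x)\<^sup>2) / (1 + r * (c / e))\<^sup>2"
  proof (rule clipped_sum_split)
    fix x
    show "c \<le> (s x - c * r) * (c / e)" if "x < j"
    proof -
      have "e \<le> s x - c * r" using that assms(1,2) by (simp add: e_def descending_def)
      then have "e * (c / e) \<le> (s x - c * r) * (c / e)" using e assms(3) by (intro mult_right_mono) auto
      then show ?thesis using e by simp
    qed
    show "(s x - c * r) * (c / e) \<le> c" if "j \<le> x" "x < k"
    proof -
      have "s x - c * r \<le> e" using that assms(1) by (simp add: e_def descending_def)
      then have "(s x - c * r) * (c / e) \<le> e * (c / e)" using e assms(3) by (intro mult_right_mono) auto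
      then show ?thesis using e by simp
    qed
  qed (use e assms in auto)
  also have "real j * c\<^sup>2 / (c / e)\<^sup>2 = real j * e\<^sup>2"
    using assms(3) e by (simp add: power_divide)
  also have "1 + r * (c / e) = s j / e"
    using e sj by (simp add: field_simps)
  finally show ?thesis by (simp add: power_divide e_def)
qed

definition scan_test :: bexp where
  "scan_test =
    (let e = RSub (RRead ''a'' (nvar ''j'')) (RMul (rvar ''xi'') (rvar ''rho'')) in
     BAnd (NLess (nvar ''j'') (nvar ''card''))
    (BAnd (RLess (RMul (rvar ''xi'') (rvar ''rho'')) (RRead ''a'' (nvar ''j'')))
          (RLess (RMul (rvar ''delta'') (rvar ''delta''))
            (RAdd (RMul (RNat (nvar ''j'')) (RMul e e))
                  (RDiv (RMul (rvar ''r'') (RMul e e))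
                        (RMul (RRead ''a'' (nvar ''j'')) (RRead ''a'' (nvar ''j''))))))))"

definition scan_step :: com where
  "scan_step =
    Seq (rset ''r'' (RSub (rvar ''r'') (RMul (RRead ''a'' (nvar ''j'')) (RRead ''a'' (nvar ''j'')))))
        (nset ''j'' (NAdd (nvar ''j'') (NConst 1)))"

definition scan :: com where
  "scan = Seq (nset ''j'' (NConst 0)) (While scan_test scan_step)"

definition scan_cost :: "nat \<Rightarrow> nat" where
  "scan_cost k = max_cost (nset ''j'' (NConst 0)) + while_cost scan_test k (max_cost scan_step)"

text \<open>
  The scan passes \<open>j\<close> only if the sum at the breakpoint of its entry exceeds \<open>\<delta>\<^sup>2\<close>, its value at \<open>\<theta>\<close>; by
  monotonicity the breakpoint is then at most \<open>\<theta>\<close> and the entry is saturated at \<open>\<theta>\<close>. If the test fails,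
  either the entry never saturates or its breakpoint is at least \<open>\<theta>\<close>, and by the ordering this extends
  to all later entries.
\<close>

lemma scan_correct:
  assumes "nats s ''card'' 0 = k" "descending (reals s ''a'') 0 k"
    and r: "reals s ''r'' 0 = (\<Sum>x<k. (reals s ''a'' x)\<^sup>2)"
    and c: "reals s ''xi'' 0 = c" "0 < c" and \<rho>: "reals s ''rho'' 0 = \<rho>" "0 < \<rho>"
    and \<delta>: "reals s ''delta'' 0 = \<delta>"
    and mono: "\<And>\<theta> \<theta>'. 0 < \<theta> \<Longrightarrow> \<theta> \<le> \<theta>' \<Longrightarrow>
      (\<Sum>x<k. clipped_square c \<rho> \<theta>' (reals s ''a'' x)) \<le> (\<Sum>x<k. clipped_square c \<rho> \<theta> (reals s ''a'' x))"
    and strict: "\<And>\<theta> \<theta>'. 0 < \<theta> \<Longrightarrow> \<theta> < \<theta>' \<Longrightarrow>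
      (\<Sum>x<k. clipped_square c \<rho> \<theta>' (reals s ''a'' x)) < (\<Sum>x<k. clipped_square c \<rho> \<theta> (reals s ''a'' x))"
    and \<theta>: "0 < \<theta>" "(\<Sum>x<k. clipped_square c \<rho> \<theta> (reals s ''a'' x)) = \<delta>\<^sup>2"
  shows "achieves scan s (scan_cost k)
    (\<lambda>s'. 0 \<le> reals s' ''r'' 0 \<and>
      \<delta>\<^sup>2 = real (nats s' ''j'' 0) * c\<^sup>2 / \<theta>\<^sup>2 + reals s' ''r'' 0 / (1 + \<rho> * \<theta>)\<^sup>2)"
  unfolding scan_def scan_cost_def
proof (rule achieves_Seq)
  let ?a = "reals s ''a''"
  let ?g = "\<lambda>\<theta>. \<Sum>x<k. clipped_square c \<rho> \<theta> (?a x)"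
  let ?init = "nset ''j'' (NConst 0)"
  define I where "I n t \<longleftrightarrow> nats t ''card'' 0 = k \<and> reals t ''a'' = ?a \<and> reals t ''xi'' 0 = c \<and>
    reals t ''rho'' 0 = \<rho> \<and> reals t ''delta'' 0 = \<delta> \<and> n = k - nats t ''j'' 0 \<and>
    nats t ''j'' 0 \<le> k \<and> (\<forall>x<nats t ''j'' 0. c \<le> (?a x - c * \<rho>) * \<theta>) \<and>
    reals t ''r'' 0 = (\<Sum>x=nats t ''j'' 0..<k. (?a x)\<^sup>2)" for n and t :: state
  have test: "bval scan_test t \<longleftrightarrow> j < k \<and> c * \<rho> < ?a j \<and> \<delta>\<^sup>2 < ?g (c / (?a j - c * \<rho>))"
    if "I n t" "j = nats t ''j'' 0" for n t j
  proof (cases "j < k \<and> c * \<rho> < ?a j")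
    case True
    show ?thesis
      using that True clipped_sum_at_breakpoint[OF assms(2) _ c(2) \<rho>(2), of j]
      by (simp add: scan_test_def Let_def I_def flip: power2_eq_square)
  next
    case False
    then show ?thesis using that by (auto simp: scan_test_def Let_def I_def)
  qed
  show "achieves ?init s (max_cost ?init) (I k)"
    using assms by (intro achieves_run) (auto simp: I_def lessThan_atLeast0)
  fix t assume t: "I k t"
  have "achieves (While scan_test scan_step) t (while_cost scan_test k (max_cost scan_step))
      (\<lambda>s'. (\<exists>n. I n s') \<and> \<not> bval scan_test s')"
    unfolding while_cost_def
  proof (rule achieves_While[where I = I, OF t])
    fix n and t :: state assume a: "I n t" "bval scan_test t"
    define j where "j = nats t ''j'' 0"
    have j: "j < k" "c * \<rho> < ?a j" "\<delta>\<^sup>2 < ?g (c / (?a j - c * \<rho>))"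
      using test[OF a(1) j_def] a(2) by auto
    have "c / (?a j - c * \<rho>) \<le> \<theta>"
    proof (rule ccontr)
      assume "\<not> ?thesis"
      then show False using mono[OF \<theta>(1), of "c / (?a j - c * \<rho>)"] j(3) \<theta>(2) by simp
    qed
    then have new: "c \<le> (?a j - c * \<rho>) * \<theta>" using j(2) by (simp add: field_simps)
    have "I (n - 1) (run scan_step t)"
      using a(1) j new unfolding I_def
      by (auto simp: scan_step_def less_Suc_eq sum.atLeast_Suc_lessThan power2_eq_square simp flip: j_def)
    then have "achieves scan_step t (max_cost scan_step) (I (n - 1))"
      by (intro achieves_run) (simp_all add: scan_step_def)
    moreover have "0 < n" using a(1) j(1) by (simp add: I_def j_def)
    ultimately show "0 < n \<and> achieves scan_step t (max_cost scan_step) (I (n - 1))" by blast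
  qed
  then show "achieves (While scan_test scan_step) t (while_cost scan_test k (max_cost scan_step))
      (\<lambda>s'. 0 \<le> reals s' ''r'' 0 \<and>
      \<delta>\<^sup>2 = real (nats s' ''j'' 0) * c\<^sup>2 / \<theta>\<^sup>2 + reals s' ''r'' 0 / (1 + \<rho> * \<theta>)\<^sup>2)"
  proof (rule achieves_mono[OF _ order_refl])
    fix s' assume "(\<exists>n. I n s') \<and> \<not> bval scan_test s'"
    then obtain n where n: "I n s'" "\<not> bval scan_test s'" by blast
    define j where "j = nats s' ''j'' 0"
    have stop: "\<not> (j < k \<and> c * \<rho> < ?a j \<and> \<delta>\<^sup>2 < ?g (c / (?a j - c * \<rho>)))"
      using test[OF n(1) j_def] n(2) by simp
    have "?g \<theta> = real j * c\<^sup>2 / \<theta>\<^sup>2 + (\<Sum>x=j..<k. (?a x)\<^sup>2) / (1 + \<rho> * \<theta>)\<^sup>2"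
    proof (rule clipped_sum_split)
      fix x assume x: "j \<le> x" "x < k"
      have "?a x - c * \<rho> \<le> ?a j - c * \<rho>" using x assms(2) by (simp add: descending_def)
      then have le: "(?a x - c * \<rho>) * \<theta> \<le> (?a j - c * \<rho>) * \<theta>" using \<theta>(1) by simp
      show "(?a x - c * \<rho>) * \<theta> \<le> c"
      proof (cases "c * \<rho> < ?a j")
        case True
        have "\<theta> \<le> c / (?a j - c * \<rho>)"
        proof (rule ccontr)
          assume "\<not> ?thesis"
          then show False using strict[of "c / (?a j - c * \<rho>)" \<theta>] stop x True c(2) \<theta>(2) by auto
        qed
        then have "(?a j - c * \<rho>) * \<theta> \<le> c" using True by (simp add: field_simps)
        then show ?thesis using le by linarith
      next
        case False
        then have "(?a j - c * \<rho>) * \<theta> \<le> 0" using \<theta>(1) by (intro mult_nonpos_nonneg) auto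
        then show ?thesis using le c(2) by linarith
      qed
    qed (use n(1) \<theta>(1) \<rho>(2) in \<open>auto simp: I_def j_def\<close>)
    then show "0 \<le> reals s' ''r'' 0 \<and>
      \<delta>\<^sup>2 = real (nats s' ''j'' 0) * c\<^sup>2 / \<theta>\<^sup>2 + reals s' ''r'' 0 / (1 + \<rho> * \<theta>)\<^sup>2"
      using n(1) \<theta>(2) by (simp add: I_def j_def sum_nonneg)
  qed
qed

section \<open>Solving the quartic\<close>

text \<open>
  The coefficients are those of \<open>J (1 + \<rho> x)\<^sup>2 + R x\<^sup>2 - \<Delta> x\<^sup>2 (1 + \<rho> x)\<^sup>2\<close> for \<open>J = j \<xi>\<^sup>2\<close> and \<open>\<Delta> = \<delta>\<^sup>2\<close>.
\<close>

definition solve_quartic :: com where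
  "solve_quartic =
    (let J = RMul (RNat (nvar ''j'')) (RMul (rvar ''xi'') (rvar ''xi''));
         \<rho> = rvar ''rho''; \<Delta> = RMul (rvar ''delta'') (rvar ''delta'');
         zero = RNat (NConst 0); two = RNat (NConst 2) in
    Seq (Roots ''x'' ''y'' J (RMul two (RMul J \<rho>)) (RSub (RAdd (RMul J (RMul \<rho> \<rho>)) (rvar ''r'')) \<Delta>)
          (RSub zero (RMul two (RMul \<Delta> \<rho>))) (RSub zero (RMul \<Delta> (RMul \<rho> \<rho>))))
        (rset ''theta'' (RRead ''x'' (NSub (nvar ''y'') (NConst 1)))))"

text \<open>
  The right-hand side decreases strictly, since \<open>J\<close> and \<open>R\<close> cannot both vanish when its value \<open>\<delta>\<close> is
  positive.
\<close>

lemma saturated_equation_unique: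
  fixes J R \<rho> \<delta> \<theta> \<theta>' :: real
  assumes "0 \<le> J" "0 \<le> R" "0 < \<rho>" "0 < \<delta>" "0 < \<theta>" "0 < \<theta>'"
    and "\<delta> = J / \<theta>\<^sup>2 + R / (1 + \<rho> * \<theta>)\<^sup>2" "\<delta> = J / \<theta>'\<^sup>2 + R / (1 + \<rho> * \<theta>')\<^sup>2"
  shows "\<theta> = \<theta>'"
proof -
  have less: False if "0 < x" "x < y" "\<delta> = J / x\<^sup>2 + R / (1 + \<rho> * x)\<^sup>2" "\<delta> = J / y\<^sup>2 + R / (1 + \<rho> * y)\<^sup>2" for x y
  proof -
    have "0 < 1 + \<rho> * x" "1 + \<rho> * x < 1 + \<rho> * y"
      using that assms(3) by (auto intro!: add_pos_pos mult_pos_pos)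
    then have p: "x\<^sup>2 < y\<^sup>2" "(1 + \<rho> * x)\<^sup>2 < (1 + \<rho> * y)\<^sup>2" "0 < x\<^sup>2" "0 < (1 + \<rho> * x)\<^sup>2"
      using that(1,2) by (simp_all add: power_strict_mono)
    have q: "0 < y\<^sup>2 * x\<^sup>2" "0 < (1 + \<rho> * y)\<^sup>2 * (1 + \<rho> * x)\<^sup>2"
      using p by (meson less_trans mult_pos_pos)+
    have le: "J / y\<^sup>2 \<le> J / x\<^sup>2" "R / (1 + \<rho> * y)\<^sup>2 \<le> R / (1 + \<rho> * x)\<^sup>2"
      using divide_left_mono[OF less_imp_le[OF p(1)] assms(1) q(1)]
        divide_left_mono[OF less_imp_le[OF p(2)] assms(2) q(2)] by simp_all
    show False
    proof (cases "J = 0")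
      case True
      then have "R \<noteq> 0" using that(3) assms(4) by auto
      then have "R / (1 + \<rho> * y)\<^sup>2 < R / (1 + \<rho> * x)\<^sup>2"
        using assms(2) by (intro divide_strict_left_mono p q) simp
      then show False using le that by linarith
    next
      case False
      then have "J / y\<^sup>2 < J / x\<^sup>2"
        using assms(1) by (intro divide_strict_left_mono p q) simp
      then show False using le that by linarith
    qed
  qed
  show ?thesis using less[of \<theta> \<theta>'] less[of \<theta>' \<theta>] assms by (cases \<theta> \<theta>' rule: linorder_cases) auto
qed

lemma quartic_root_iff:
  fixes J R \<rho> \<Delta> x :: real
  assumes "0 < x" "0 < \<rho>"
  shows "poly [:J, 2 * (J * \<rho>), J * (\<rho> * \<rho>) + R - \<Delta>, - (2 * (\<Delta> * \<rho>)), - (\<Delta> * (\<rho> * \<rho>)):] x = 0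
    \<longleftrightarrow> \<Delta> = J / x\<^sup>2 + R / (1 + \<rho> * x)\<^sup>2"
proof -
  have nz: "x\<^sup>2 \<noteq> 0" "(1 + \<rho> * x)\<^sup>2 \<noteq> 0" using assms by (auto simp: add_pos_pos, smt (verit) mult_pos_pos)
  have "poly [:J, 2 * (J * \<rho>), J * (\<rho> * \<rho>) + R - \<Delta>, - (2 * (\<Delta> * \<rho>)), - (\<Delta> * (\<rho> * \<rho>)):] x
      = J * (1 + \<rho> * x)\<^sup>2 + R * x\<^sup>2 - \<Delta> * (x\<^sup>2 * (1 + \<rho> * x)\<^sup>2)"
    by (simp add: algebra_simps power2_eq_square)
  moreover have "\<Delta> = J / x\<^sup>2 + R / (1 + \<rho> * x)\<^sup>2 \<longleftrightarrow> J * (1 + \<rho> * x)\<^sup>2 + R * x\<^sup>2 = \<Delta> * (x\<^sup>2 * (1 + \<rho> * x)\<^sup>2)"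
    using nz by (auto simp: add_frac_eq eq_divide_eq)
  ultimately show ?thesis by simp
qed

lemma solve_quartic_correct:
  assumes "reals s ''xi'' 0 = c" "reals s ''rho'' 0 = \<rho>" "0 < \<rho>" "reals s ''delta'' 0 = \<delta>" "0 < \<delta>"
    and "0 \<le> reals s ''r'' 0" "0 < \<theta>"
    and eq: "\<delta>\<^sup>2 = real (nats s ''j'' 0) * c\<^sup>2 / \<theta>\<^sup>2 + reals s ''r'' 0 / (1 + \<rho> * \<theta>)\<^sup>2"
  shows "achieves solve_quartic s (max_cost solve_quartic) (\<lambda>s'. reals s' ''theta'' 0 = \<theta>)"
proof (rule achieves_run)
  define J where "J = real (nats s ''j'' 0) * (c * c)"
  define \<Delta> where "\<Delta> = \<delta> * \<delta>"
  define R where "R = reals s ''r'' 0"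
  have pos: "0 \<le> J" "0 \<le> R" "0 < \<Delta>" using assms by (auto simp: J_def R_def \<Delta>_def)
  have eq': "\<Delta> = J / \<theta>\<^sup>2 + R / (1 + \<rho> * \<theta>)\<^sup>2"
    using eq by (simp add: \<Delta>_def J_def R_def power2_eq_square)
  have "write_list (real_roots J (2 * (J * \<rho>)) (J * (\<rho> * \<rho>) + R - \<Delta>) (- (2 * (\<Delta> * \<rho>))) (- (\<Delta> * (\<rho> * \<rho>)))) f
      (length (real_roots J (2 * (J * \<rho>)) (J * (\<rho> * \<rho>) + R - \<Delta>) (- (2 * (\<Delta> * \<rho>))) (- (\<Delta> * (\<rho> * \<rho>)))) - 1) = \<theta>" for f
  proof (rule last_real_root)
    show "poly [:J, 2 * (J * \<rho>), J * (\<rho> * \<rho>) + R - \<Delta>, - (2 * (\<Delta> * \<rho>)), - (\<Delta> * (\<rho> * \<rho>)):] \<theta> = 0"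
      using quartic_root_iff[OF assms(7,3)] eq' by blast
    show "x = \<theta>" if "0 < x" "poly [:J, 2 * (J * \<rho>), J * (\<rho> * \<rho>) + R - \<Delta>, - (2 * (\<Delta> * \<rho>)), - (\<Delta> * (\<rho> * \<rho>)):] x = 0" for x
      using saturated_equation_unique[OF pos(1,2) assms(3) pos(3) that(1) assms(7) _ eq']
        quartic_root_iff[OF that(1) assms(3)] that(2) by blast
    show "[:J, 2 * (J * \<rho>), J * (\<rho> * \<rho>) + R - \<Delta>, - (2 * (\<Delta> * \<rho>)), - (\<Delta> * (\<rho> * \<rho>)):] \<noteq> 0"
      using pos(3) assms(3) by simp
  qed (rule assms(7))
  then show "reals (run solve_quartic s) ''theta'' 0 = \<theta>"
    using assms(1,2,4) by (simp add: solve_quartic_def Let_def flip: J_def R_def \<Delta>_def)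
qed (simp add: solve_quartic_def Let_def)


section \<open>The complete program\<close>

lemma store_mat_entry:
  assumes "A \<in> carrier_mat m n" "(i, j) \<in> positions m n"
  shows "store_mat A (i * n + j) = A $$ (i, j)"
proof -
  have ij: "i < m" "j < n" using assms(2) by (auto simp: positions_def)
  have "i * n + j < Suc i * n" using ij by simp
  also have "\<dots> \<le> m * n" using ij by (intro mult_right_mono) auto
  finally show ?thesis using assms(1) ij by (simp add: store_mat_def)
qed

lemma load_entries_writes:
  "nat_writes load_entries = {''i''}" "real_writes load_entries = {''r'', ''x'', ''a''}"
  by (auto simp: load_entries_def load_step_def Let_def)

lemma compute_xi_writes:
  "nat_writes compute_xi = {''w'', ''y''}" "real_writes compute_xi = {''x'', ''xi''}"
  by (auto simp: compute_xi_def)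

lemma merge_sort_writes:
  "nat_writes merge_sort = {''i'', ''j'', ''p'', ''u'', ''v'', ''w''}" "real_writes merge_sort = {''a'', ''b''}"
  by (auto simp: merge_sort_def merge_pass_def merge_step_def new_block_def emit_larger_def
      copy_back_def copy_step_def)

lemma scan_writes: "nat_writes scan = {''j''}" "real_writes scan = {''r''}"
  by (auto simp: scan_def scan_step_def)

text \<open>
  The case \<open>\<parallel>A\<parallel> > \<delta>\<close>, in which \<^const>\<open>theta_star\<close> is positive.
\<close>

definition large_case :: com where
  "large_case = Seq compute_xi (Seq merge_sort (Seq scan solve_quartic))"

definition large_test :: bexp where
  "large_test = RLess (RMul (rvar ''delta'') (rvar ''delta'')) (rvar ''r'')"

definition theta_program :: com where
  "theta_program = Seq load_entries (If large_test large_case (rset ''theta'' (RNat (NConst 0))))"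

definition large_cost :: "nat \<Rightarrow> nat \<Rightarrow> nat" where
  "large_cost k l = max_cost compute_xi + (merge_sort_cost k l + (scan_cost k + max_cost solve_quartic))"

definition theta_cost :: "nat \<Rightarrow> nat \<Rightarrow> nat" where
  "theta_cost k l = load_cost k + (1 + bcost large_test + large_cost k l)"

lemma large_case_correct:
  assumes s: "nats s ''card'' 0 = k" "nats s ''m'' 0 = m" "nats s ''n'' 0 = n"
    "reals s ''rho'' 0 = \<rho>" "reals s ''delta'' 0 = \<delta>"
    and a: "\<And>x. x < k \<Longrightarrow> reals s ''a'' x = \<bar>d x\<bar>" and r: "reals s ''r'' 0 = (\<Sum>x<k. (d x)\<^sup>2)"
    and pos: "0 < m" "0 < \<rho>" "0 < \<delta>" and big: "0 < (\<Sum>x<k. (d x)\<^sup>2)" and k: "k \<le> 2 ^ l"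
    and \<theta>: "0 < \<theta>" "(\<Sum>x<k. clipped_square (xi m n) \<rho> \<theta> \<bar>d x\<bar>) = \<delta>\<^sup>2"
  shows "achieves large_case s (large_cost k l) (\<lambda>s'. reals s' ''theta'' 0 = \<theta>)"
  unfolding large_case_def large_cost_def
proof (rule achieves_Seq)
  let ?c = "xi m n"
  have c: "0 < ?c" using pos(1) by (rule xi_pos)
  have mono: "(\<Sum>x<k. clipped_square ?c \<rho> \<theta>' \<bar>d x\<bar>) \<le> (\<Sum>x<k. clipped_square ?c \<rho> \<theta> \<bar>d x\<bar>)" if "0 < \<theta>" "\<theta> \<le> \<theta>'" for \<theta> \<theta>'
    using that pos c by (intro sum_mono clipped_mono) auto
  have strict: "(\<Sum>x<k. clipped_square ?c \<rho> \<theta>' \<bar>d x\<bar>) < (\<Sum>x<k. clipped_square ?c \<rho> \<theta> \<bar>d x\<bar>)" if "0 < \<theta>" "\<theta> < \<theta>'" for \<theta> \<theta>'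
    using that pos c big by (intro clipped_sum_strict_mono) auto
  show "achieves compute_xi s (max_cost compute_xi)
      (\<lambda>s'. reals s' ''xi'' 0 = ?c \<and> (\<forall>x. x \<notin> nat_writes compute_xi \<longrightarrow> nats s' x = nats s x) \<and>
        (\<forall>x. x \<notin> real_writes compute_xi \<longrightarrow> reals s' x = reals s x))"
    using s pos by (intro achieves_frame[OF compute_xi_correct])
  fix s1 :: state
  assume "reals s1 ''xi'' 0 = ?c \<and> (\<forall>x. x \<notin> nat_writes compute_xi \<longrightarrow> nats s1 x = nats s x) \<and>
        (\<forall>x. x \<notin> real_writes compute_xi \<longrightarrow> reals s1 x = reals s x)"
  then have s1: "nats s1 ''card'' 0 = k" "reals s1 ''rho'' 0 = \<rho>" "reals s1 ''delta'' 0 = \<delta>"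
    "reals s1 ''a'' = reals s ''a''" "reals s1 ''r'' = reals s ''r''" "reals s1 ''xi'' 0 = ?c"
    using s by (simp_all add: compute_xi_writes)
  show "achieves (Seq merge_sort (Seq scan solve_quartic)) s1
      (merge_sort_cost k l + (scan_cost k + max_cost solve_quartic)) (\<lambda>s'. reals s' ''theta'' 0 = \<theta>)"
  proof (rule achieves_Seq)
    show "achieves merge_sort s1 (merge_sort_cost k l)
      (\<lambda>s'. (descending (reals s' ''a'') 0 k \<and> sums_agree k (reals s1 ''a'') (reals s' ''a'')) \<and>
        (\<forall>x. x \<notin> nat_writes merge_sort \<longrightarrow> nats s' x = nats s1 x) \<and>
        (\<forall>x. x \<notin> real_writes merge_sort \<longrightarrow> reals s' x = reals s1 x))"
      by (rule achieves_frame[OF merge_sort_correct[OF s1(1) k]])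
    fix s2 :: state
    assume a2: "(descending (reals s2 ''a'') 0 k \<and> sums_agree k (reals s1 ''a'') (reals s2 ''a'')) \<and>
        (\<forall>x. x \<notin> nat_writes merge_sort \<longrightarrow> nats s2 x = nats s1 x) \<and>
        (\<forall>x. x \<notin> real_writes merge_sort \<longrightarrow> reals s2 x = reals s1 x)"
    then have s2: "nats s2 ''card'' 0 = k" "reals s2 ''rho'' 0 = \<rho>" "reals s2 ''delta'' 0 = \<delta>"
      "reals s2 ''r'' = reals s ''r''" "reals s2 ''xi'' 0 = ?c"
      using s1 by (simp_all add: merge_sort_writes)
    have agree: "(\<Sum>x<k. h (reals s2 ''a'' x)) = (\<Sum>x<k. h \<bar>d x\<bar>)" for h :: "real \<Rightarrow> real"
    proof -
      have "(\<Sum>x<k. h (reals s2 ''a'' x)) = (\<Sum>x<k. h (reals s ''a'' x))"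
        using a2 s1(4) by (simp add: sums_agree_def)
      then show ?thesis using a by simp
    qed
    show "achieves (Seq scan solve_quartic) s2 (scan_cost k + max_cost solve_quartic) (\<lambda>s'. reals s' ''theta'' 0 = \<theta>)"
    proof (rule achieves_Seq)
      show "achieves scan s2 (scan_cost k)
        (\<lambda>s'. (0 \<le> reals s' ''r'' 0 \<and>
          \<delta>\<^sup>2 = real (nats s' ''j'' 0) * ?c\<^sup>2 / \<theta>\<^sup>2 + reals s' ''r'' 0 / (1 + \<rho> * \<theta>)\<^sup>2) \<and>
          (\<forall>x. x \<notin> nat_writes scan \<longrightarrow> nats s' x = nats s2 x) \<and>
          (\<forall>x. x \<notin> real_writes scan \<longrightarrow> reals s' x = reals s2 x))"
      proof (rule achieves_frame, rule scan_correct)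
        show "reals s2 ''r'' 0 = (\<Sum>x<k. (reals s2 ''a'' x)\<^sup>2)"
          using s2(4) r agree[of "\<lambda>x. x\<^sup>2"] by simp
      qed (use s2 c pos a2 \<theta> mono strict in \<open>simp_all add: agree\<close>)
      fix s3 :: state
      assume a3: "(0 \<le> reals s3 ''r'' 0 \<and>
          \<delta>\<^sup>2 = real (nats s3 ''j'' 0) * ?c\<^sup>2 / \<theta>\<^sup>2 + reals s3 ''r'' 0 / (1 + \<rho> * \<theta>)\<^sup>2) \<and>
          (\<forall>x. x \<notin> nat_writes scan \<longrightarrow> nats s3 x = nats s2 x) \<and>
          (\<forall>x. x \<notin> real_writes scan \<longrightarrow> reals s3 x = reals s2 x)"
      then have "reals s3 ''xi'' 0 = ?c" "reals s3 ''rho'' 0 = \<rho>" "reals s3 ''delta'' 0 = \<delta>"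
        using s2 by (simp_all add: scan_writes)
      then show "achieves solve_quartic s3 (max_cost solve_quartic) (\<lambda>s'. reals s' ''theta'' 0 = \<theta>)"
        using a3 pos \<theta>(1) by (intro solve_quartic_correct[where c = ?c and \<rho> = \<rho> and \<delta> = \<delta>]) auto
    qed
  qed
qed

lemma sum_over_enumeration:
  assumes "distinct \<omega>" "set \<omega> = \<Omega>" "\<Omega> \<subseteq> positions m n" "h 0 = (0::real)"
    and A: "\<And>ij. ij \<in> positions m n \<Longrightarrow> A ij = (if ij \<in> \<Omega> then e ij else 0)"
  shows "(\<Sum>x<length \<omega>. h (e (\<omega> ! x))) = (\<Sum>ij\<in>positions m n. h (A ij))"
proof -
  have "(\<Sum>x<length \<omega>. h (e (\<omega> ! x))) = (\<Sum>ij\<in>\<Omega>. h (e ij))"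
    by (rule sum.reindex_bij_betw[OF bij_betw_nth[OF assms(1) refl assms(2)[symmetric]]])
  also have "\<dots> = (\<Sum>ij\<in>positions m n. h (A ij))"
    using assms by (intro sum.mono_neutral_cong_left) auto
  finally show ?thesis .
qed

lemma theta_program_correct:
  assumes data: "pns_data m n D Lt Q \<Omega> \<rho> \<delta>" and "0 < \<delta>" and \<omega>: "distinct \<omega>" "set \<omega> = \<Omega>"
    and k: "card \<Omega> \<le> 2 ^ l"
  defines "q \<equiv> q_mat \<rho> Q Lt"
  shows "achieves theta_program (input_state m n D q \<omega> \<rho> \<delta>) (theta_cost (card \<Omega>) l)
    (\<lambda>s. reals s ''theta'' 0 = theta_star m n \<rho> \<delta> (proj \<Omega> (D - q)))"
  unfolding theta_program_def theta_cost_def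
proof (rule achieves_Seq)
  note d = pns_dataD[OF data, folded q_def]
  let ?s = "input_state m n D q \<omega> \<rho> \<delta>" and ?A = "proj \<Omega> (D - q)" and ?k = "card \<Omega>"
  define e where "e ij = D $$ ij - q $$ ij" for ij
  have len: "length \<omega> = ?k" using \<omega> distinct_card by force
  have carr: "?A \<in> carrier_mat m n" using d by (simp add: carrier_simps)
  have Aij: "?A $$ ij = (if ij \<in> \<Omega> then e ij else 0)" if "ij \<in> positions m n" for ij
    using that d by (simp add: e_def entry_simps[where m=m and n=n] carrier_simps)
  have sums: "(\<Sum>x<?k. h (e (\<omega> ! x))) = (\<Sum>ij\<in>positions m n. h (?A $$ ij))" if "h 0 = 0" for h :: "real \<Rightarrow> real"
    using sum_over_enumeration[where h = h and A = "\<lambda>ij. ?A $$ ij" and e = e, OF \<omega> d(6) that Aij] len by simp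
  have entry: "reals ?s ''D'' (nats ?s ''row'' x * nats ?s ''n'' 0 + nats ?s ''col'' x)
      - reals ?s ''q'' (nats ?s ''row'' x * nats ?s ''n'' 0 + nats ?s ''col'' x) = e (\<omega> ! x)"
    if "x < ?k" for x
  proof -
    have "\<omega> ! x \<in> positions m n" using that len \<omega>(2) d(6) nth_mem[of x \<omega>] by auto
    then have "store_mat M (fst (\<omega> ! x) * n + snd (\<omega> ! x)) = M $$ (\<omega> ! x)" if "M \<in> carrier_mat m n" for M
      using store_mat_entry[OF that, of "fst (\<omega> ! x)" "snd (\<omega> ! x)"] by simp
    then show ?thesis using that len d by (simp add: input_state_def e_def)
  qed
  have card: "nats ?s ''card'' 0 = ?k" using len by (simp add: input_state_def)
  show "achieves load_entries ?s (load_cost ?k)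
    (\<lambda>s'. ((\<forall>x<?k. reals s' ''a'' x = \<bar>e (\<omega> ! x)\<bar>) \<and> reals s' ''r'' 0 = (\<Sum>x<?k. (e (\<omega> ! x))\<^sup>2)) \<and>
      (\<forall>x. x \<notin> nat_writes load_entries \<longrightarrow> nats s' x = nats ?s x) \<and>
      (\<forall>x. x \<notin> real_writes load_entries \<longrightarrow> reals s' x = reals ?s x))"
    by (rule achieves_frame, rule achieves_mono[OF load_entries_correct[OF card] order_refl])
      (simp add: entry)
  fix s1 :: state
  assume a1: "((\<forall>x<?k. reals s1 ''a'' x = \<bar>e (\<omega> ! x)\<bar>) \<and> reals s1 ''r'' 0 = (\<Sum>x<?k. (e (\<omega> ! x))\<^sup>2)) \<and>
      (\<forall>x. x \<notin> nat_writes load_entries \<longrightarrow> nats s1 x = nats ?s x) \<and>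
      (\<forall>x. x \<notin> real_writes load_entries \<longrightarrow> reals s1 x = reals ?s x)"
  then have s1: "nats s1 ''card'' 0 = ?k" "nats s1 ''m'' 0 = m" "nats s1 ''n'' 0 = n"
    "reals s1 ''rho'' 0 = \<rho>" "reals s1 ''delta'' 0 = \<delta>"
    using len by (simp_all add: load_entries_writes input_state_def)
  have r: "reals s1 ''r'' 0 = (\<Sum>ij\<in>positions m n. (?A $$ ij)\<^sup>2)"
    using a1 sums[of "\<lambda>x. x\<^sup>2"] by simp
  have test: "bval large_test s1 \<longleftrightarrow> \<not> fro_norm ?A \<le> \<delta>"
    using fro_norm_le_iff[OF carr d(8)] s1 r by (auto simp: large_test_def power2_eq_square)
  show "achieves (If large_test large_case (rset ''theta'' (RNat (NConst 0)))) s1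
      (1 + bcost large_test + large_cost ?k l) (\<lambda>s. reals s ''theta'' 0 = theta_star m n \<rho> \<delta> ?A)"
  proof (rule achieves_If)
    assume "bval large_test s1"
    then have big: "\<not> fro_norm ?A \<le> \<delta>" using test by simp
    define \<theta> where "\<theta> = theta_star m n \<rho> \<delta> ?A"
    have \<theta>: "0 < \<theta>" "phi m n \<rho> ?A \<theta> = \<delta>"
      using theI'[OF phi_eq_ex1[OF carr d(1,7) \<open>0 < \<delta>\<close> big]] big by (auto simp: \<theta>_def theta_star_def)
    have "achieves large_case s1 (large_cost ?k l) (\<lambda>s. reals s ''theta'' 0 = \<theta>)"
    proof (rule large_case_correct[OF s1])
      have "(\<Sum>x<?k. clipped_square (xi m n) \<rho> \<theta> \<bar>e (\<omega> ! x)\<bar>) = (\<Sum>ij\<in>positions m n. clipped_square (xi m n) \<rho> \<theta> \<bar>?A $$ ij\<bar>)"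
        using d(9) \<theta>(1) by (intro sums) (simp add: clipped_square_def)
      then show "(\<Sum>x<?k. clipped_square (xi m n) \<rho> \<theta> \<bar>e (\<omega> ! x)\<bar>) = \<delta>\<^sup>2"
        using phi_squared[OF carr, of \<rho> \<theta>] \<theta>(2) by simp
      have "\<delta>\<^sup>2 < (\<Sum>ij\<in>positions m n. (?A $$ ij)\<^sup>2)"
        using big fro_norm_le_iff[OF carr d(8)] by simp
      then have "0 < (\<Sum>ij\<in>positions m n. (?A $$ ij)\<^sup>2)"
        by (rule le_less_trans[OF zero_le_power2])
      then show "0 < (\<Sum>x<?k. (e (\<omega> ! x))\<^sup>2)"
        using sums[of "\<lambda>x. x\<^sup>2"] by simp
    qed (use a1 d \<open>0 < \<delta>\<close> k \<theta>(1) in auto)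
    then show "achieves large_case s1 (large_cost ?k l) (\<lambda>s. reals s ''theta'' 0 = theta_star m n \<rho> \<delta> ?A)"
      by (simp add: \<theta>_def)
  next
    assume "\<not> bval large_test s1"
    then have "theta_star m n \<rho> \<delta> ?A = 0" using test by (simp add: theta_star_def)
    then have "achieves (rset ''theta'' (RNat (NConst 0))) s1 (max_cost (rset ''theta'' (RNat (NConst 0))))
        (\<lambda>s. reals s ''theta'' 0 = theta_star m n \<rho> \<delta> ?A)"
      by (intro achieves_run) auto
    then show "achieves (rset ''theta'' (RNat (NConst 0))) s1 (large_cost ?k l)
        (\<lambda>s. reals s ''theta'' 0 = theta_star m n \<rho> \<delta> ?A)"
      by (rule achieves_mono) (auto simp: large_cost_def compute_xi_def)
  qed
qed

section \<open>Running time\<close>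

lemma while_cost_le:
  assumes "bcost b \<le> 99" "T \<le> M"
  shows "while_cost b n T \<le> 100 + n * (100 + M)"
  unfolding while_cost_def using assms by (intro add_mono mult_le_mono) auto

text \<open>
  Only the existence of constants matters; round ones keep the arithmetic of the total small.
\<close>

lemma loop_free_costs:
  "max_cost (Seq (nset ''i'' (NConst 0)) (rset ''r'' (RNat (NConst 0)))) \<le> 100"
  "max_cost load_step \<le> 100" "max_cost compute_xi \<le> 100"
  "max_cost (Seq (nset ''p'' (NConst 0)) new_block) \<le> 100" "max_cost merge_step \<le> 200"
  "max_cost (nset ''p'' (NConst 0)) \<le> 100" "max_cost copy_step \<le> 100"
  "max_cost (nset ''w'' (NConst 1)) \<le> 100" "max_cost (nset ''w'' (NAdd (nvar ''w'') (nvar ''w''))) \<le> 100"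
  "max_cost (nset ''j'' (NConst 0)) \<le> 100" "max_cost scan_step \<le> 100" "max_cost solve_quartic \<le> 200"
  "bcost scan_test \<le> 99" "bcost large_test \<le> 99"
  by (simp_all add: load_step_def compute_xi_def new_block_def merge_step_def emit_larger_def
      copy_step_def scan_test_def scan_step_def solve_quartic_def large_test_def Let_def)

lemma theta_cost_le: "theta_cost k l \<le> 2000 * ((k + 1) * (l + 1))"
proof -
  note c = loop_free_costs
  have load: "load_cost k \<le> 100 + (100 + k * (100 + 100))"
    unfolding load_cost_def by (intro add_mono while_cost_le c) simp
  have pass: "merge_pass_cost k \<le> 100 + (100 + k * (100 + 200))"
    unfolding merge_pass_cost_def by (intro add_mono while_cost_le c) simp
  have copy: "copy_back_cost k \<le> 100 + (100 + k * (100 + 100))"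
    unfolding copy_back_cost_def by (intro add_mono while_cost_le c) simp
  have scan: "scan_cost k \<le> 100 + (100 + k * (100 + 100))"
    unfolding scan_cost_def by (intro add_mono while_cost_le c)
  have sort: "merge_sort_cost k l \<le> 100 + (100 + l * (100 +
      (100 + (100 + k * (100 + 200)) + (100 + (100 + k * (100 + 100)) + 100))))"
    unfolding merge_sort_cost_def by (intro add_mono while_cost_le c pass copy) simp
  have "theta_cost k l \<le> 1200 + 400 * k + 600 * l + 500 * (k * l)"
    using load scan sort c(3,12,14) unfolding theta_cost_def large_cost_def
    by (simp add: algebra_simps)
  then show ?thesis by (simp add: algebra_simps)
qed

definition log_ceiling :: "nat \<Rightarrow> nat" where "log_ceiling k = nat \<lceil>log 2 (real k)\<rceil>"

lemma le_power_log_ceiling: "k \<le> 2 ^ log_ceiling k"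
proof (cases "k = 0")
  case False
  have "log 2 (real k) \<le> real (log_ceiling k)"
    unfolding log_ceiling_def by (rule real_nat_ceiling_ge)
  then have "2 powr log 2 (real k) \<le> 2 powr real (log_ceiling k)"
    by (rule powr_mono) simp
  then have "real k \<le> real (2 ^ log_ceiling k)" using False by (simp add: powr_realpow)
  then show ?thesis by (simp only: of_nat_le_iff)
qed simp

lemma theta_cost_bigo: "(\<lambda>k. real (theta_cost k (log_ceiling k))) \<in> O(\<lambda>k. real k * ln (real k))"
proof (rule bigoI)
  show "\<forall>\<^sub>F k in sequentially. norm (real (theta_cost k (log_ceiling k)))
      \<le> 12000 / ln 2 * norm (real k * ln (real k))"
    using eventually_ge_at_top[of 2]
  proof eventually_elim
    fix k :: nat assume k: "2 \<le> k"
    define L where "L = log 2 (real k)"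
    have L: "1 \<le> L" using k log_le_cancel_iff[of 2 2 "real k"] by (simp add: L_def)
    have "real (nat \<lceil>L\<rceil>) = real_of_int \<lceil>L\<rceil>" "real_of_int \<lceil>L\<rceil> \<le> L + 1"
      using L by (simp_all add: order.trans[OF _ L])
    then have l: "real (log_ceiling k) + 1 \<le> 3 * L"
      using L unfolding log_ceiling_def L_def by linarith
    have "real (theta_cost k (log_ceiling k)) \<le> 2000 * ((real k + 1) * (real (log_ceiling k) + 1))"
    proof -
      have "real (theta_cost k (log_ceiling k)) \<le> real (2000 * ((k + 1) * (log_ceiling k + 1)))"
        by (intro of_nat_mono theta_cost_le)
      then show ?thesis by (simp only: of_nat_mult of_nat_add of_nat_numeral of_nat_1)
    qed
    also have "\<dots> \<le> 2000 * ((2 * real k) * (3 * L))"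
      using k l by (intro mult_left_mono mult_mono) auto
    also have "\<dots> = 12000 / ln 2 * (real k * ln (real k))"
      by (simp add: L_def log_def)
    finally show "norm (real (theta_cost k (log_ceiling k))) \<le> 12000 / ln 2 * norm (real k * ln (real k))"
      using k by simp
  qed
qed

lemma theta_program_time:
  assumes "pns_data m n D Lt Q \<Omega> \<rho> \<delta>" "0 < \<delta>" "distinct \<omega>" "set \<omega> = \<Omega>"
  shows "\<exists>t s. exec theta_program (input_state m n D (q_mat \<rho> Q Lt) \<omega> \<rho> \<delta>) t s \<and>
    reals s ''theta'' 0 = theta_star m n \<rho> \<delta> (proj \<Omega> (D - q_mat \<rho> Q Lt)) \<and>
    real t \<le> real (theta_cost (card \<Omega>) (log_ceiling (card \<Omega>)))"
  using theta_program_correct[OF assms le_power_log_ceiling] by (auto simp: achieves_def)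

section \<open>Closed form and running time\<close>

lemma noisy_optimal:
  assumes data: "pns_data m n D Lt Q \<Omega> \<rho> \<delta>" and "0 < \<delta>"
  defines "q \<equiv> q_mat \<rho> Q Lt"
  defines "A \<equiv> proj \<Omega> (D - q)"
  defines "\<theta> \<equiv> theta_star m n \<rho> \<delta> A"
  defines "S' \<equiv> S_noisy m n D q \<Omega> \<rho> \<theta>" and "L' \<equiv> L_noisy m n D q \<Omega> \<rho> \<theta>"
  shows "pns_optimal m n D Lt Q \<Omega> \<rho> \<delta> (L', S') \<and>
     (\<forall>L S. pns_optimal m n D Lt Q \<Omega> \<rho> \<delta> (L, S) \<longrightarrow>
        L = L' \<and> proj \<Omega> S = proj \<Omega> S' \<and> (\<delta> \<le> fro_norm A \<or> \<Omega> = positions m n \<longrightarrow> S = S'))"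
proof (cases "fro_norm A \<le> \<delta>")
  case True
  then have "\<theta> = 0" by (simp add: \<theta>_def theta_star_def)
  then show ?thesis
    using noisy_optimal_inactive[OF data] True unfolding S'_def L'_def A_def q_def by blast
next
  case False
  note d = pns_dataD[OF data]
  have "A \<in> carrier_mat m n" using d by (simp add: A_def q_def carrier_simps)
  then have "0 < \<theta>" "phi m n \<rho> A \<theta> = \<delta>"
    using theI'[OF phi_eq_ex1[of A m n \<rho> \<delta>]] d \<open>0 < \<delta>\<close> False by (auto simp: \<theta>_def theta_star_def)
  then show ?thesis
    using noisy_optimal_active[OF data \<open>0 < \<delta>\<close>] unfolding S'_def L'_def A_def q_def by blast
qed

theorem lemma6p1:
  shows
    "(\<forall>(m::nat) (n::nat) D Lt Q \<Omega> \<rho> \<delta>. pns_data m n D Lt Q \<Omega> \<rho> \<delta> \<longrightarrow>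
       (let q = q_mat \<rho> Q Lt; A = proj \<Omega> (D - q) in
        (0 < \<delta> \<longrightarrow>
          (\<not> fro_norm A \<le> \<delta> \<longrightarrow> (\<exists>!\<theta>. 0 < \<theta> \<and> phi m n \<rho> A \<theta> = \<delta>)) \<and>
          (let \<theta> = theta_star m n \<rho> \<delta> A;
               S' = S_noisy m n D q \<Omega> \<rho> \<theta>;
               L' = L_noisy m n D q \<Omega> \<rho> \<theta> in
           pns_optimal m n D Lt Q \<Omega> \<rho> \<delta> (L', S') \<and>
           (\<forall>L S. pns_optimal m n D Lt Q \<Omega> \<rho> \<delta> (L, S) \<longrightarrow>
              L = L' \<and> proj \<Omega> S = proj \<Omega> S' \<and>
              (\<delta> \<le> fro_norm A \<or> \<Omega> = positions m n \<longrightarrow> S = S')))) \<and>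
        (\<delta> = 0 \<longrightarrow>
          (let S' = S_exact m n D q \<Omega> \<rho>;
               L' = L_exact m n D q \<Omega> \<rho> in
           pns_optimal m n D Lt Q \<Omega> \<rho> \<delta> (L', S') \<and>
           (\<forall>L S. pns_optimal m n D Lt Q \<Omega> \<rho> \<delta> (L, S) \<longrightarrow> L = L' \<and> S = S')))))
     \<and>
     (\<exists>(prog::com) (T::nat \<Rightarrow> real).
        T \<in> O(\<lambda>k. real k * ln (real k)) \<and>
        (\<forall>(m::nat) (n::nat) D Lt Q \<Omega> \<rho> \<delta> \<omega>.
           pns_data m n D Lt Q \<Omega> \<rho> \<delta> \<and> 0 < \<delta> \<and> distinct \<omega> \<and> set \<omega> = \<Omega> \<longrightarrow>
           (let q = q_mat \<rho> Q Lt in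
            \<exists>t s. exec prog (input_state m n D q \<omega> \<rho> \<delta>) t s \<and>
                  reals s ''theta'' 0 = theta_star m n \<rho> \<delta> (proj \<Omega> (D - q)) \<and>
                  real t \<le> T (card \<Omega>))))"
proof (intro conjI allI impI)
  fix m n :: nat and D Lt Q :: "real mat" and \<Omega> and \<rho> \<delta> :: real
  assume data: "pns_data m n D Lt Q \<Omega> \<rho> \<delta>"
  note d = pns_dataD[OF data]
  let ?q = "q_mat \<rho> Q Lt"
  let ?A = "proj \<Omega> (D - ?q)"
  have A: "?A \<in> carrier_mat m n" using d by (simp add: carrier_simps)
  show "let q = q_mat \<rho> Q Lt; A = proj \<Omega> (D - q) in
        (0 < \<delta> \<longrightarrow>
          (\<not> fro_norm A \<le> \<delta> \<longrightarrow> (\<exists>!\<theta>. 0 < \<theta> \<and> phi m n \<rho> A \<theta> = \<delta>)) \<and>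
          (let \<theta> = theta_star m n \<rho> \<delta> A;
               S' = S_noisy m n D q \<Omega> \<rho> \<theta>;
               L' = L_noisy m n D q \<Omega> \<rho> \<theta> in
           pns_optimal m n D Lt Q \<Omega> \<rho> \<delta> (L', S') \<and>
           (\<forall>L S. pns_optimal m n D Lt Q \<Omega> \<rho> \<delta> (L, S) \<longrightarrow>
              L = L' \<and> proj \<Omega> S = proj \<Omega> S' \<and>
              (\<delta> \<le> fro_norm A \<or> \<Omega> = positions m n \<longrightarrow> S = S')))) \<and>
        (\<delta> = 0 \<longrightarrow>
          (let S' = S_exact m n D q \<Omega> \<rho>;
               L' = L_exact m n D q \<Omega> \<rho> in
           pns_optimal m n D Lt Q \<Omega> \<rho> \<delta> (L', S') \<and>
           (\<forall>L S. pns_optimal m n D Lt Q \<Omega> \<rho> \<delta> (L, S) \<longrightarrow> L = L' \<and> S = S')))"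
    unfolding Let_def
  proof (rule conjI; rule impI)
    assume "0 < \<delta>"
    then show "(\<not> fro_norm ?A \<le> \<delta> \<longrightarrow> (\<exists>!\<theta>. 0 < \<theta> \<and> phi m n \<rho> ?A \<theta> = \<delta>)) \<and>
      pns_optimal m n D Lt Q \<Omega> \<rho> \<delta>
        (L_noisy m n D ?q \<Omega> \<rho> (theta_star m n \<rho> \<delta> ?A), S_noisy m n D ?q \<Omega> \<rho> (theta_star m n \<rho> \<delta> ?A)) \<and>
      (\<forall>L S. pns_optimal m n D Lt Q \<Omega> \<rho> \<delta> (L, S) \<longrightarrow>
        L = L_noisy m n D ?q \<Omega> \<rho> (theta_star m n \<rho> \<delta> ?A) \<and>
        proj \<Omega> S = proj \<Omega> (S_noisy m n D ?q \<Omega> \<rho> (theta_star m n \<rho> \<delta> ?A)) \<and>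
        (\<delta> \<le> fro_norm ?A \<or> \<Omega> = positions m n \<longrightarrow> S = S_noisy m n D ?q \<Omega> \<rho> (theta_star m n \<rho> \<delta> ?A)))"
      using phi_eq_ex1[OF A d(1,7)] noisy_optimal[OF data] by blast
  next
    assume "\<delta> = 0"
    then show "pns_optimal m n D Lt Q \<Omega> \<rho> \<delta> (L_exact m n D ?q \<Omega> \<rho>, S_exact m n D ?q \<Omega> \<rho>) \<and>
      (\<forall>L S. pns_optimal m n D Lt Q \<Omega> \<rho> \<delta> (L, S) \<longrightarrow>
        L = L_exact m n D ?q \<Omega> \<rho> \<and> S = S_exact m n D ?q \<Omega> \<rho>)"
      using exact_optimal[of m n D Lt Q \<Omega> \<rho>] data by blast
  qed
next
  show "\<exists>(prog::com) (T::nat \<Rightarrow> real).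
        T \<in> O(\<lambda>k. real k * ln (real k)) \<and>
        (\<forall>(m::nat) (n::nat) D Lt Q \<Omega> \<rho> \<delta> \<omega>.
           pns_data m n D Lt Q \<Omega> \<rho> \<delta> \<and> 0 < \<delta> \<and> distinct \<omega> \<and> set \<omega> = \<Omega> \<longrightarrow>
           (let q = q_mat \<rho> Q Lt in
            \<exists>t s. exec prog (input_state m n D q \<omega> \<rho> \<delta>) t s \<and>
                  reals s ''theta'' 0 = theta_star m n \<rho> \<delta> (proj \<Omega> (D - q)) \<and>
                  real t \<le> T (card \<Omega>)))"
    using theta_cost_bigo theta_program_time unfolding Let_def
    by (intro exI[of _ theta_program] exI[of _ "\<lambda>k. real (theta_cost k (log_ceiling k))"]) blast
qed

end
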